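(* Let $n\ge7$ and let $u,v,w\in S_n$ be given in one-line notation by $$u=v=(2,1,3,4,5,\dots,n-2,n,n-1),\qquad w=(4,1,2,3,5,\dots,n-2,n,n-1).$$ Then $c_{N*u,N*v}^{N*w}=1$ for $N=2n-6$, and $c_{N*u,N*v}^{N*w}=0$ for all $N\ge 2n-5$.
   Context: $S_n$ is the symmetric group on $[n]$, embedded in $S_{n+1}$ by fixing $n+1$, and $S_\infty=\bigcup_n S_n$. Schubert polynomials $\mathfrak S_w$ ($w\in S_\infty$) are defined as follows. For $w_0=(n,\dots,1)\in S_n$, put $\mathfrak S_{w_0}=x_1^{n-1}\cdots x_{n-1}$. If $w(i)<w(i+1)$, put $\mathfrak S_w=\partial_i\mathfrak S_{ws_i}$, where $\partial_i f=(f-s_if)/(x_i-x_{i+1})$. They form a $\mathbb Z$-basis of $\mathbb Z[x_1,x_2,\dots]$. Schubert coefficients $c_{u,v}^w$ are defined by $\mathfrak S_u\mathfrak S_v=\sum_w c_{u,v}^w\mathfrak S_w$. The Lehmer code of $w\in S_n$ is $(c_1(w),\dots,c_n(w))$ with $c_i(w)=|\{j>i:w(j)<w(i)\}|$, and it determines $w$. For $N\ge1$, $N*w\in S_{Nn}$ is the permutation with Lehmer code $(Nc_1(w),\dots,Nc_n(w),0,\dots,0)$. *)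

theory Defs
  imports Complex_Main "HOL-Library.Poly_Mapping" "HOL-Combinatorics.Permutations"
begin

(* Permutations of [n] are functions on nat with w permutes {1..n}; the embedding of S_n into
   S_(n+1) is then the identity. *)

definition S_infty :: "(nat \<Rightarrow> nat) set" where
  "S_infty = {w. \<exists>n. w permutes {1..n}}"

definition one_line :: "nat list \<Rightarrow> nat \<Rightarrow> nat" where
  "one_line xs i = (if 1 \<le> i \<and> i \<le> length xs then xs ! (i - 1) else i)"

(* Integer polynomials in x_0, x_1, x_2, ...: finitely supported coefficient functions on
   finitely supported exponent vectors. The Schubert polynomials only involve x_1, x_2, ...;
   x_0 is present merely because variables are indexed by nat. *)

type_synonym zpoly = "(nat \<Rightarrow>\<^sub>0 nat) \<Rightarrow>\<^sub>0 int"

definition var :: "nat \<Rightarrow> zpoly" where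
  "var i = Poly_Mapping.single (Poly_Mapping.single i 1) 1"

(* The action of s_i on polynomials exchanges x_i and x_(i+1). In map_key, the key map is
   applied contravariantly; this is immaterial here as the transposition is an involution. *)

definition swap_vars :: "nat \<Rightarrow> zpoly \<Rightarrow> zpoly" where
  "swap_vars i = Poly_Mapping.map_key (Poly_Mapping.map_key (transpose i (i + 1)))"

(* f - s_i f is divisible by x_i - x_(i+1), and zpoly is an integral domain, so the quotient
   exists and is unique. *)

definition divided_difference :: "nat \<Rightarrow> zpoly \<Rightarrow> zpoly" where
  "divided_difference i f = (THE g. (var i - var (i + 1)) * g = f - swap_vars i f)"

(* The recursion defining Schubert polynomials, as a relation: neither the ambient S_n nor the
   choice of ascents is prescribed. That it is single-valued on S_infty is the classical
   well-definedness of Schubert polynomials. The side condition i >= 1 matters because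
   permutations here are also defined at 0. *)

inductive schubert_rel :: "(nat \<Rightarrow> nat) \<Rightarrow> zpoly \<Rightarrow> bool" where
  longest: "schubert_rel (one_line (rev [1..<n + 1])) (\<Prod>i = 1..n. var i ^ (n - i))"
| ascent: "1 \<le> i \<Longrightarrow> w i < w (i + 1) \<Longrightarrow> schubert_rel (w \<circ> transpose i (i + 1)) f
    \<Longrightarrow> schubert_rel w (divided_difference i f)"

definition schubert :: "(nat \<Rightarrow> nat) \<Rightarrow> zpoly" where
  "schubert w = (THE f. schubert_rel w f)"

(* All c_(u,v)^w at once: the finitely supported coordinate vector of the product with respect
   to the basis of Schubert polynomials indexed by S_infty. *)

definition schubert_expansion ::
    "(nat \<Rightarrow> nat) \<Rightarrow> (nat \<Rightarrow> nat) \<Rightarrow> ((nat \<Rightarrow> nat) \<Rightarrow>\<^sub>0 int)" where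
  "schubert_expansion u v = (THE c. Poly_Mapping.keys c \<subseteq> S_infty \<and>
     schubert u * schubert v =
       (\<Sum>w\<in>Poly_Mapping.keys c. of_int (Poly_Mapping.lookup c w) * schubert w))"

definition schubert_coeff :: "(nat \<Rightarrow> nat) \<Rightarrow> (nat \<Rightarrow> nat) \<Rightarrow> (nat \<Rightarrow> nat) \<Rightarrow> int" where
  "schubert_coeff u v w = Poly_Mapping.lookup (schubert_expansion u v) w"

definition lehmer_code :: "nat \<Rightarrow> (nat \<Rightarrow> nat) \<Rightarrow> nat list" where
  "lehmer_code n w = map (\<lambda>i. card {j. i < j \<and> j \<le> n \<and> w j < w i}) [1..<n + 1]"

(* N * w for w in S_n and N >= 1; n has to be given since w alone does not determine it. *)

definition code_dilation :: "nat \<Rightarrow> nat \<Rightarrow> (nat \<Rightarrow> nat) \<Rightarrow> nat \<Rightarrow> nat" where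
  "code_dilation n N w = (THE z. z permutes {1..N * n} \<and>
     lehmer_code (N * n) z = map (\<lambda>c. N * c) (lehmer_code n w) @ replicate (N * n - n) 0)"

end

theory Submission
  imports Defs
begin

text \<open>
  The functional $\varphi_w$ that takes a polynomial to the constant term of its image under the
  divided difference operator of $w$ is dual to the Schubert basis, so the coefficient is
  $\varphi_{N*w}(\mathfrak S_{N*u}^2)$. Write $m = n - 1$, $d = m - 1$ and
  $h_a^{(k)} = h_a(x_1,\dots,x_k)$. The permutation $N*u$ has code $(N, 0^{m-2}, N)$, whence
  $\mathfrak S_{N*u} = x_1^N h_N^{(m)} - x_1^{N+d} h_{N-d}^{(m)}$. Applying
  $\partial_{m-1} \cdots \partial_1$ takes $x_1^r F$ to $h_{r-d}^{(m)} F$ for $F$ symmetric in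
  $x_1,\dots,x_m$ and takes the code $(3N, 0^{m-2}, N)$ to the Grassmannian code
  $(0^{m-2}, N, 3N-d)$, for which the variables may be reduced to two. It remains to count the
  occurrences of a two-row shape in products of three complete homogeneous polynomials:
  $(N+1) - 2(N-d+1) + \max(0, N+1-2d)$, which is $1$ for $N = 2d-2$ and $0$ for $N \ge 2d-1$.
\<close>

section \<open>Divided differences\<close>

text \<open>Much of the work precedes the computation: \<open>schubert\<close>,
  \<open>schubert_expansion\<close> and \<open>code_dilation\<close> are definite descriptions, so
  well-definedness, the basis property and uniqueness of codes have to be established. Reduced words
  are avoided: a recursion along descents is path independent once its operators satisfy the
  commutation and braid relations. The basis property then rests on rigidity: a polynomial in
  finitely many variables all of whose divided differences vanish is constant, so by induction on
  the degree one killed by all functionals is zero. Rigidity also yields the formula for the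
  Schubert polynomial of the dilated u: only divided differences and constant terms are compared.
  Two variables suffice because the Grassmannian code begins with m - 2 zeros: the permutation is 1
  \<times> ... \<times> 1 \<times> z, and setting x_1 to 0 while lowering all other indices turns
  \<partial>_{i+1} into \<partial>_i. The first two counts alone give 2d - 1 - N, which is 1 at N =
  2d - 2, 0 at N = 2d - 1 and negative afterwards; exactly from there on the third count
  compensates.\<close>

lemma update_eq_add:
  "k \<notin> Poly_Mapping.keys f \<Longrightarrow> Poly_Mapping.update k v f = f + Poly_Mapping.single k v"
  by (rule poly_mapping_eqI)
     (auto simp: lookup_update lookup_add lookup_single when_def in_keys_iff)

lemma var_mult_single:
  "var j * Poly_Mapping.single m c = Poly_Mapping.single (Poly_Mapping.single j 1 + m) c"
  by (simp add: var_def mult_single)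

text \<open>Identities between ring homomorphisms thus need checking on variables only. A monomial
  is rebuilt from its exponent vector one key at a time, and each exponent one factor at a
  time.\<close>

lemma zpoly_induct [case_names const add var]:
  assumes const: "\<And>c. P (of_int c)"
    and add: "\<And>f g. P f \<Longrightarrow> P g \<Longrightarrow> P (f + g)"
    and var: "\<And>j f. P f \<Longrightarrow> P (var j * f)"
  shows "P (f :: zpoly)"
proof -
  have m: "P (Poly_Mapping.single m c)" for m c
  proof (induction m rule: update_induct)
    case const
    show ?case using assms(1)[of c] by (simp add: single_of_int[symmetric])
  next
    case (update m j a)
    have "P (Poly_Mapping.single (m + Poly_Mapping.single j b) c)" for b
    proof (induction b)
      case 0
      then show ?case using update by simp
    next
      case (Suc b)
      have "Poly_Mapping.single j (Suc b) = Poly_Mapping.single j 1 + Poly_Mapping.single j b"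
        by (simp flip: single_add)
      then show ?case using var[OF Suc, of j] by (simp add: var_mult_single ac_simps)
    qed
    then show ?case using update by (simp add: update_eq_add)
  qed
  show ?thesis
  proof (induction f rule: update_induct)
    case const
    show ?case using assms(1)[of 0] by simp
  next
    case (update f k v)
    then show ?case using m add by (simp add: update_eq_add)
  qed
qed

section \<open>The exchange of adjacent variables as a ring involution\<close>

lemma inj_map_key:
  assumes "bij g"
  shows "inj (Poly_Mapping.map_key g :: ('a \<Rightarrow>\<^sub>0 'b::zero) \<Rightarrow> _)"
proof (rule injI)
  fix p q :: "'a \<Rightarrow>\<^sub>0 'b"
  assume *: "Poly_Mapping.map_key g p = Poly_Mapping.map_key g q"
  have "Poly_Mapping.lookup p (g k) = Poly_Mapping.lookup q (g k)" for k
    using arg_cong[OF *, of "\<lambda>r. Poly_Mapping.lookup r k"] assms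
    by (simp add: map_key.rep_eq bij_is_inj)
  then show "p = q"
    using assms by (metis poly_mapping_eqI bij_pointE)
qed

text \<open>The rules for \<open>map_key\<close> ask for an injective key map. In
  \<open>swap_vars\<close> the outer key map is itself a \<open>map_key\<close>, acting on exponent
  vectors.\<close>

lemma inj_map_key_transpose [simp]:
  "inj (Poly_Mapping.map_key (transpose i j) :: ('a \<Rightarrow>\<^sub>0 'b::zero) \<Rightarrow> _)"
  by (rule inj_map_key) simp

lemma map_key_transpose_map_key_transpose [simp]:
  "Poly_Mapping.map_key (transpose i j) (Poly_Mapping.map_key (transpose i j) p) = p"
  by (simp add: map_key_compose map_key_id[folded id_def])

lemma map_key_transpose_single:
  "Poly_Mapping.map_key (transpose i j) (Poly_Mapping.single k c) = Poly_Mapping.single (transpose i j k) c"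
  using map_key_single[of "transpose i j" "transpose i j k" c] by simp

lemma swap_vars_single:
  "swap_vars i (Poly_Mapping.single m c) =
    Poly_Mapping.single (Poly_Mapping.map_key (transpose i (i + 1)) m) c"
proof -
  let ?t = "Poly_Mapping.map_key (transpose i (i + 1)) :: (nat \<Rightarrow>\<^sub>0 nat) \<Rightarrow> _"
  have "Poly_Mapping.map_key ?t (Poly_Mapping.single (?t (?t m)) c) = Poly_Mapping.single (?t m) c"
    by (rule map_key_single) (rule inj_map_key_transpose)
  then show ?thesis by (simp add: swap_vars_def)
qed

lemma swap_vars_add: "swap_vars i (f + g) = swap_vars i f + swap_vars i g"
  unfolding swap_vars_def by (rule map_key_plus) simp

lemma swap_vars_of_int [simp]: "swap_vars i (of_int c) = of_int c"
proof -
  have "swap_vars i (Poly_Mapping.single 0 c) = Poly_Mapping.single 0 c"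
    by (simp add: swap_vars_single)
  then show ?thesis using single_of_int[of c, where ?'a = "nat \<Rightarrow>\<^sub>0 nat" and ?'b = int] by simp
qed

lemma swap_vars_0 [simp]: "swap_vars i 0 = 0"
  using swap_vars_of_int[of i 0] by simp

lemma swap_vars_1 [simp]: "swap_vars i 1 = 1"
  using swap_vars_of_int[of i 1] by simp

lemma swap_vars_var [simp]: "swap_vars i (var j) = var (transpose i (i + 1) j)"
  by (simp add: var_def swap_vars_single map_key_transpose_single)

lemma swap_vars_uminus: "swap_vars i (- f) = - swap_vars i f"
  using swap_vars_add[of i f "- f"] by (simp add: eq_neg_iff_add_eq_0 add.commute)

lemma swap_vars_diff: "swap_vars i (f - g) = swap_vars i f - swap_vars i g"
  using swap_vars_add[of i f "- g"] by (simp add: swap_vars_uminus)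

lemma swap_vars_swap_vars [simp]: "swap_vars i (swap_vars i f) = f"
  unfolding swap_vars_def by (simp add: map_key_compose o_def map_key_id)

lemma swap_vars_var_mult: "swap_vars i (var j * f) = swap_vars i (var j) * swap_vars i f"
proof (induction f rule: update_induct)
  case const
  then show ?case by simp
next
  case (update f k v)
  have "swap_vars i (var j * Poly_Mapping.single k v) = swap_vars i (var j) * swap_vars i (Poly_Mapping.single k v)"
    by (simp only: var_mult_single swap_vars_single swap_vars_var)
       (simp add: map_key_plus map_key_transpose_single)
  then show ?case using update by (simp add: update_eq_add swap_vars_add algebra_simps)
qed

lemma swap_vars_of_int_mult: "swap_vars i (of_int c * f) = of_int c * swap_vars i f"
proof (induction f rule: update_induct)
  case const
  then show ?case by simp
next
  case (update f k v)
  have "swap_vars i (of_int c * Poly_Mapping.single k v) = of_int c * swap_vars i (Poly_Mapping.single k v)"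
    by (simp add: single_of_int[symmetric] mult_single swap_vars_single del: single_of_int)
  then show ?case using update by (simp add: update_eq_add swap_vars_add algebra_simps)
qed

lemma swap_vars_mult: "swap_vars i (f * g) = swap_vars i f * swap_vars i g"
proof (induction f rule: zpoly_induct)
  case (const c)
  then show ?case by (simp add: swap_vars_of_int_mult)
next
  case (add f g)
  then show ?case by (simp add: swap_vars_add algebra_simps)
next
  case (var j f)
  then show ?case by (simp only: mult.assoc swap_vars_var_mult)
qed

lemma swap_vars_power: "swap_vars i (f ^ n) = swap_vars i f ^ n"
  by (induction n) (simp_all add: swap_vars_mult)

lemma swap_vars_prod: "swap_vars i (\<Prod>a\<in>A. f a) = (\<Prod>a\<in>A. swap_vars i (f a))"
  by (induction A rule: infinite_finite_induct) (simp_all add: swap_vars_mult)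

lemma swap_vars_commute:
  assumes "i + 2 \<le> j"
  shows "swap_vars i (swap_vars j f) = swap_vars j (swap_vars i f)"
  by (induction f rule: zpoly_induct)
     (use assms in \<open>auto simp: swap_vars_add swap_vars_mult transpose_def\<close>)

text \<open>Both sides are ring endomorphisms, so only the variables remain, where this is the braid
  relation of transpositions.\<close>

lemma swap_vars_braid:
  "swap_vars i (swap_vars (i+1) (swap_vars i f)) = swap_vars (i+1) (swap_vars i (swap_vars (i+1) f))"
  by (induction f rule: zpoly_induct)
     (auto simp: swap_vars_add swap_vars_mult transpose_def)

lemma var_eq_iff [simp]: "var i = var j \<longleftrightarrow> i = j"
proof
  assume "var i = var j"
  then have "Poly_Mapping.single i 1 = Poly_Mapping.single j (1::nat)"
    \<comment> \<open>\<open>frag_of\<close> abbreviates \<open>Poly_Mapping.single\<close> with the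
      integer value 1, so \<open>frag_of_eq\<close> is injectivity in the key.\<close>
    unfolding var_def by (simp only: frag_of_eq)
  then have "Poly_Mapping.keys (Poly_Mapping.single i (1::nat)) = Poly_Mapping.keys (Poly_Mapping.single j (1::nat))"
    by (rule arg_cong)
  then show "i = j" by simp
qed simp

section \<open>Divided differences: existence, twisted Leibniz rule, nil-Coxeter relations\<close>

lemma divided_difference_eqI:
  assumes "(var i - var (i + 1)) * g = f - swap_vars i f"
  shows "divided_difference i f = g"
  unfolding divided_difference_def
proof (rule the_equality)
  fix h assume "(var i - var (i + 1)) * h = f - swap_vars i f"
  then have "(var i - var (i + 1)) * h = (var i - var (i + 1)) * g" using assms by simp
  then show "h = g" by simp
qed (rule assms)

text \<open>The quotient is built up along the generators; the product step is the twisted Leibniz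
  rule, with \<open>e\<close> the quotient for the variable alone.\<close>

lemma divided_difference_exists: "\<exists>g. (var i - var (i + 1)) * g = f - swap_vars i f"
proof (induction f rule: zpoly_induct)
  case (const c)
  show ?case by (rule exI[of _ 0]) simp
next
  case (add f g)
  then obtain f' g' where "(var i - var (i + 1)) * f' = f - swap_vars i f"
    "(var i - var (i + 1)) * g' = g - swap_vars i g" by blast
  then show ?case by (intro exI[of _ "f' + g'"]) (simp add: swap_vars_add algebra_simps)
next
  case (var j f)
  then obtain g where g: "(var i - var (i + 1)) * g = f - swap_vars i f" by blast
  define e :: zpoly where "e = (if j = i then 1 else if j = i + 1 then -1 else 0)"
  have e: "(var i - var (i + 1)) * e = var j - swap_vars i (var j)"
    by (simp add: e_def transpose_def)
  have "(var i - var (i + 1)) * (e * f + swap_vars i (var j) * g) =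
      ((var i - var (i + 1)) * e) * f + swap_vars i (var j) * ((var i - var (i + 1)) * g)"
    by (simp only: algebra_simps)
  also have "\<dots> = var j * f - swap_vars i (var j * f)"
    unfolding e g swap_vars_mult by (simp only: algebra_simps)
  finally show ?case by blast
qed

lemma divided_difference_mult_diff:
  "(var i - var (i + 1)) * divided_difference i f = f - swap_vars i f"
  using divided_difference_exists[of i f] divided_difference_eqI by metis

lemma divided_difference_add:
  "divided_difference i (f + g) = divided_difference i f + divided_difference i g"
  by (rule divided_difference_eqI)
     (simp only: distrib_left divided_difference_mult_diff swap_vars_add, simp)

lemma divided_difference_eq_0_iff: "divided_difference i f = 0 \<longleftrightarrow> swap_vars i f = f"
  using divided_difference_mult_diff[of i f] by (auto intro: divided_difference_eqI)

lemma divided_difference_of_int [simp]: "divided_difference i (of_int c) = 0"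
  by (simp add: divided_difference_eq_0_iff)

lemma divided_difference_0 [simp]: "divided_difference i 0 = 0"
  using divided_difference_of_int[of i 0] by simp

lemma divided_difference_1 [simp]: "divided_difference i 1 = 0"
  using divided_difference_of_int[of i 1] by simp

lemma divided_difference_mult:
  "divided_difference i (f * g) = divided_difference i f * g + swap_vars i f * divided_difference i g"
proof (rule divided_difference_eqI)
  have "(var i - var (i + 1)) * (divided_difference i f * g + swap_vars i f * divided_difference i g) =
    ((var i - var (i + 1)) * divided_difference i f) * g +
    swap_vars i f * ((var i - var (i + 1)) * divided_difference i g)"
    by (simp only: algebra_simps)
  also have "\<dots> = f * g - swap_vars i (f * g)"
    unfolding divided_difference_mult_diff swap_vars_mult by (simp only: algebra_simps)
  finally show "(var i - var (i + 1)) *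
      (divided_difference i f * g + swap_vars i f * divided_difference i g) = f * g - swap_vars i (f * g)" .
qed

lemma divided_difference_of_int_mult:
  "divided_difference i (of_int c * f) = of_int c * divided_difference i f"
  by (simp add: divided_difference_mult)

lemma divided_difference_uminus: "divided_difference i (- f) = - divided_difference i f"
  using divided_difference_of_int_mult[of i "-1" f] by simp

lemma divided_difference_diff:
  "divided_difference i (f - g) = divided_difference i f - divided_difference i g"
  using divided_difference_add[of i f "- g"] by (simp add: divided_difference_uminus)

lemma divided_difference_mult_symmetric:
  "swap_vars i g = g \<Longrightarrow> divided_difference i (f * g) = divided_difference i f * g"
  using divided_difference_eq_0_iff[of i g] by (simp add: divided_difference_mult)

lemma divided_difference_symmetric_mult:
  "swap_vars i g = g \<Longrightarrow> divided_difference i (g * f) = g * divided_difference i f"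
  using divided_difference_mult_symmetric[of i g f] by (simp add: mult.commute)

lemma divided_difference_var:
  "divided_difference i (var j) = (if j = i then 1 else if j = i + 1 then -1 else 0)"
  by (rule divided_difference_eqI) (simp add: transpose_def)

lemma swap_vars_divided_difference [simp]:
  "swap_vars i (divided_difference i f) = divided_difference i f"
proof -
  have "swap_vars i ((var i - var (i + 1)) * divided_difference i f) = swap_vars i (f - swap_vars i f)"
    by (simp only: divided_difference_mult_diff)
  then have "(var (i + 1) - var i) * swap_vars i (divided_difference i f) = swap_vars i f - f"
    by (simp add: swap_vars_mult swap_vars_diff)
  then have "(var i - var (i + 1)) * swap_vars i (divided_difference i f) = f - swap_vars i f"
    by (simp add: algebra_simps)
  then show ?thesis
    by (rule divided_difference_eqI[symmetric])
qed

lemma divided_difference_divided_difference [simp]: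
  "divided_difference i (divided_difference i f) = 0"
  by (simp add: divided_difference_eq_0_iff)

text \<open>After multiplication by both differences, each invariant under the other exchange, the
  claim becomes commutation of the exchanges; the factors then cancel.\<close>

lemma divided_difference_commute:
  assumes "i + 2 \<le> j"
  shows "divided_difference i (divided_difference j f) = divided_difference j (divided_difference i f)"
proof -
  let ?a = "var i - var (i + 1)" and ?b = "var j - var (j + 1)"
  have a: "swap_vars j ?a = ?a" and b: "swap_vars i ?b = ?b"
    using assms by (simp_all add: swap_vars_diff transpose_def)
  have "?a * ?b * divided_difference i (divided_difference j f)
      = ?a * divided_difference i (?b * divided_difference j f)"
    by (simp only: divided_difference_symmetric_mult[OF b] mult.assoc)
  also have "\<dots> = (f - swap_vars j f) - swap_vars i (f - swap_vars j f)"
    by (simp only: divided_difference_mult_diff)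
  also have "\<dots> = (f - swap_vars i f) - swap_vars j (f - swap_vars i f)"
    by (simp add: swap_vars_diff swap_vars_commute[OF assms])
  also have "\<dots> = ?b * divided_difference j (?a * divided_difference i f)"
    by (simp only: divided_difference_mult_diff)
  also have "\<dots> = ?a * ?b * divided_difference j (divided_difference i f)"
    by (simp only: divided_difference_symmetric_mult[OF a] mult.assoc mult.left_commute[of ?b])
  finally show ?thesis by simp
qed

text \<open>Up to the Vandermonde factor, \<open>d\<close>, \<open>e\<close>, \<open>d\<close> in
  succession antisymmetrise over the group generated by \<open>s\<close> and \<open>t\<close>. The
  operators are abstract because the lemma is applied twice, the second time with the variables in
  reverse order.\<close>

lemma divided_difference_triple_aux:
  fixes s t d e :: "zpoly \<Rightarrow> zpoly" and a b c :: zpoly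
  assumes s_diff: "\<And>f g. s (f - g) = s f - s g" and s_mult: "\<And>f g. s (f * g) = s f * s g"
    and t_diff: "\<And>f g. t (f - g) = t f - t g" and t_mult: "\<And>f g. t (f * g) = t f * t g"
    and s: "s a = b" "s b = a" "s c = c" and t: "t a = a" "t b = c" "t c = b"
    and d: "\<And>f. (a - b) * d f = f - s f" and e: "\<And>f. (b - c) * e f = f - t f"
    and ss: "\<And>f. s (s f) = f" and "a \<noteq> b"
  shows "(a - b) * (a - c) * (b - c) * d (e (d f)) =
    f - s f - t f + t (s f) + s (t f) - s (t (s f))"
proof -
  let ?D = "(a - b) * (a - c) * (b - c)"
  define g1 where "g1 = d f"
  define g2 where "g2 = e g1"
  define g3 where "g3 = d g2"
  have 1: "(a - b) * g1 = f - s f" unfolding g1_def by (rule d)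
  have 2: "(b - c) * g2 = g1 - t g1" unfolding g2_def by (rule e)
  have 3: "(a - b) * g3 = g2 - s g2" unfolding g3_def by (rule d)
  have 4: "(a - c) * t g1 = t f - t (s f)"
    using arg_cong[OF 1, of t] by (simp only: t_mult t_diff t)
  have "?D * g2 = (a - b) * (a - c) * ((b - c) * g2)" by (simp only: ac_simps)
  also have "\<dots> = (a - c) * ((a - b) * g1) - (a - b) * ((a - c) * t g1)"
    unfolding 2 by (simp only: algebra_simps)
  finally have 5: "?D * g2 = (a - c) * (f - s f) - (a - b) * (t f - t (s f))"
    unfolding 1 4 .
  have 6: "((b - a) * (b - c) * (a - c)) * s g2 = (b - c) * (s f - f) - (b - a) * (s (t f) - s (t (s f)))"
    using arg_cong[OF 5, of s] by (simp only: s_mult s_diff s ss)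
  have "(a - b) * (?D * g3) = ?D * ((a - b) * g3)" by (simp only: ac_simps)
  also have "\<dots> = ?D * g2 + ((b - a) * (b - c) * (a - c)) * s g2"
    unfolding 3 by (simp only: algebra_simps)
  also have "\<dots> = (a - b) * (f - s f - t f + t (s f) + s (t f) - s (t (s f)))"
    unfolding 5 6 by (simp only: algebra_simps)
  finally have "?D * g3 = f - s f - t f + t (s f) + s (t f) - s (t (s f))"
    using \<open>a \<noteq> b\<close> by simp
  then show ?thesis by (simp only: g1_def g2_def g3_def)
qed

lemma divided_difference_braid:
  "divided_difference i (divided_difference (i + 1) (divided_difference i f)) =
   divided_difference (i + 1) (divided_difference i (divided_difference (i + 1) f))"
proof -
  let ?s = "swap_vars i" and ?t = "swap_vars (i + 1)"
  let ?d = "divided_difference i" and ?e = "divided_difference (i + 1)"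
  let ?a = "var i" and ?b = "var (i + 1)" and ?c = "var (i + 2)"
  have 1: "(?a - ?b) * (?a - ?c) * (?b - ?c) * ?d (?e (?d f)) =
     f - ?s f - ?t f + ?t (?s f) + ?s (?t f) - ?s (?t (?s f))"
    by (rule divided_difference_triple_aux)
       (use divided_difference_mult_diff[of i] divided_difference_mult_diff[of "i + 1"] in
         \<open>simp_all add: swap_vars_mult swap_vars_diff transpose_def\<close>)
  \<comment> \<open>Reversing the variables flips the sign of every difference, hence the operators
    with minus signs. The three flips on each side compensate.\<close>
  have 2: "(?c - ?b) * (?c - ?a) * (?b - ?a) * (- ?e (- ?d (- ?e f))) =
     f - ?t f - ?s f + ?s (?t f) + ?t (?s f) - ?t (?s (?t f))"
  proof (rule divided_difference_triple_aux[where d = "\<lambda>f. - ?e f" and e = "\<lambda>f. - ?d f"])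
    show "(?c - ?b) * - ?e f = f - ?t f" for f
      using divided_difference_mult_diff[of "i + 1" f] by (simp add: algebra_simps)
    show "(?b - ?a) * - ?d f = f - ?s f" for f
      using divided_difference_mult_diff[of i f] by (simp add: algebra_simps)
  qed (simp_all add: swap_vars_mult swap_vars_diff transpose_def)
  have "(?a - ?b) * (?a - ?c) * (?b - ?c) * ?e (?d (?e f)) =
    (?c - ?b) * (?c - ?a) * (?b - ?a) * (- ?e (- ?d (- ?e f)))"
    by (simp add: divided_difference_uminus algebra_simps)
  also have "\<dots> = (?a - ?b) * (?a - ?c) * (?b - ?c) * ?d (?e (?d f))"
    unfolding 1 2 by (simp add: swap_vars_braid[simplified])
  finally have "(?a - ?b) * (?a - ?c) * (?b - ?c) * ?e (?d (?e f)) =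
    (?a - ?b) * (?a - ?c) * (?b - ?c) * ?d (?e (?d f))" .
  moreover have "(?a - ?b) * (?a - ?c) * (?b - ?c) \<noteq> 0" by simp
  ultimately show ?thesis by (metis mult_left_cancel)
qed

section \<open>Recursion along descents\<close>

lemma permutes_comp_transpose:
  "z permutes {1..n} \<Longrightarrow> 1 \<le> i \<Longrightarrow> i < (n::nat) \<Longrightarrow> z \<circ> transpose i (i + 1) permutes {1..n}"
  by (intro permutes_compose permutes_swap_id) auto

lemma permutes_atLeast1_mono: "z permutes {1..m} \<Longrightarrow> m \<le> n \<Longrightarrow> z permutes {1..(n::nat)}"
  by (rule permutes_subset) auto

lemma S_infty_comp_transpose [simp]:
  assumes "z \<in> S_infty" "1 \<le> i"
  shows "z \<circ> transpose i (i + 1) \<in> S_infty" "z \<circ> transpose i (Suc i) \<in> S_infty"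
proof -
  obtain n where "z permutes {1..n}" using assms by (auto simp: S_infty_def)
  then have "z permutes {1..max n (i + 2)}" by (rule permutes_atLeast1_mono) simp
  then have "z \<circ> transpose i (i + 1) permutes {1..max n (i + 2)}"
    by (rule permutes_comp_transpose) (use assms(2) in auto)
  then show "z \<circ> transpose i (i + 1) \<in> S_infty" "z \<circ> transpose i (Suc i) \<in> S_infty"
    by (auto simp: S_infty_def)
qed

lemma id_in_S_infty [simp]: "id \<in> S_infty"
  by (auto simp: S_infty_def intro!: exI[of _ 0])

lemma S_infty_inj: "z \<in> S_infty \<Longrightarrow> inj z"
  by (auto simp: S_infty_def dest: permutes_inj)

lemma S_infty_0: "z \<in> S_infty \<Longrightarrow> z 0 = 0"
  by (auto simp: S_infty_def permutes_def)

lemma S_infty_not_descent_iff: "z \<in> S_infty \<Longrightarrow> \<not> z (i + 1) < z i \<longleftrightarrow> z i < z (i + 1)"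
  using inj_eq[OF S_infty_inj, of z i "i + 1"] by auto

text \<open>Such a permutation is strictly increasing, and so is its inverse; hence both dominate
  the identity.\<close>

lemma S_infty_no_descent_imp_id:
  assumes z: "z \<in> S_infty" and nd: "\<And>i. 1 \<le> i \<Longrightarrow> \<not> z (i + 1) < z i"
  shows "z = id"
proof -
  obtain n where n: "z permutes {1..n}" using z by (auto simp: S_infty_def)
  \<comment> \<open>Position 0 is not covered by \<open>nd\<close>; the ascent there comes from
    \<open>z 0 = 0\<close> and injectivity.\<close>
  have "z (Suc 0) \<noteq> z 0"
    using inj_eq[OF S_infty_inj[OF z]] by simp
  then have "z n < z (Suc n)" for n
    using nd[of n] S_infty_not_descent_iff[OF z, of n] S_infty_0[OF z] by (cases n) auto
  then have mono: "strict_mono z" by (simp add: strict_mono_Suc_iff)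
  have "strict_mono (inv z)"
  proof (rule strict_monoI)
    fix x y :: nat assume "x < y"
    then have "\<not> z (inv z y) \<le> z (inv z x)" using permutes_inverses(1)[OF n] by simp
    then show "inv z x < inv z y" using strict_mono_less_eq[OF mono] by simp
  qed
  then have "i \<le> inv z i" for i by (rule strict_mono_imp_increasing)
  moreover have "i \<le> z i" for i using mono by (rule strict_mono_imp_increasing)
  ultimately have "inv z (z i) \<ge> z i \<and> z i \<ge> i" for i by blast
  then show ?thesis by (auto simp: permutes_inverses(2)[OF n] fun_eq_iff intro: antisym)
qed

definition inversions :: "(nat \<Rightarrow> nat) \<Rightarrow> (nat \<times> nat) set" where
  "inversions z = {(a, b). a < b \<and> z b < z a}"

lemma finite_inversions:
  assumes "z \<in> S_infty"
  shows "finite (inversions z)"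
proof -
  obtain n where n: "z permutes {1..n}" using assms by (auto simp: S_infty_def)
  have "a \<le> n \<and> b \<le> n" if "a < b" "z b < z a" for a b
  proof -
    have out: "z x = x" if "n < x" for x using n that by (auto simp: permutes_def)
    have inside: "z x \<le> n" if "x \<le> n" for x
      using permutes_in_image[OF n, of x] that n by (cases "x = 0") (auto simp: permutes_def)
    show ?thesis using that out[of a] out[of b] inside[of a] by (cases "b \<le> n"; cases "a \<le> n") auto
  qed
  then have "inversions z \<subseteq> {..n} \<times> {..n}" by (auto simp: inversions_def)
  then show ?thesis by (rule finite_subset) auto
qed

text \<open>Exchanging the positions i and i + 1 maps the inversions of the new permutation
  injectively to those of \<open>z\<close> and misses (i, i + 1).\<close>

lemma card_inversions_descent:
  assumes z: "z \<in> S_infty" and d: "z (i + 1) < z i"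
  shows "card (inversions (z \<circ> transpose i (i + 1))) < card (inversions z)"
proof -
  let ?t = "transpose i (i + 1)" and ?y = "z \<circ> transpose i (i + 1)"
  have "map_prod ?t ?t ` inversions ?y \<subseteq> inversions z - {(i, i + 1)}"
  proof (rule image_subsetI)
    fix p assume p: "p \<in> inversions ?y"
    obtain a b where ab: "p = (a, b)" by force
    have "a < b" "z (?t b) < z (?t a)" using p by (auto simp: ab inversions_def)
    moreover have "(a, b) \<noteq> (i, i + 1)" using calculation d by auto
    ultimately have "?t a < ?t b \<and> (?t a, ?t b) \<noteq> (i, i + 1)"
      by (auto simp: transpose_def split: if_splits)
    then show "map_prod ?t ?t p \<in> inversions z - {(i, i + 1)}"
      using \<open>z (?t b) < z (?t a)\<close> by (simp add: ab inversions_def)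
  qed
  moreover have "(i, i + 1) \<in> inversions z" using d by (simp add: inversions_def)
  ultimately have "card (map_prod ?t ?t ` inversions ?y) < card (inversions z)"
    by (meson card_Diff1_less card_mono finite_Diff finite_inversions[OF z] le_less_trans)
  moreover have "inj_on (map_prod ?t ?t) (inversions ?y)"
    by (rule inj_on_inverseI[where g = "map_prod ?t ?t"]) (auto simp: map_prod_def)
  ultimately show ?thesis by (simp add: card_image)
qed

lemma S_infty_descent_induct [consumes 1, case_names descent]:
  assumes "z \<in> S_infty"
    and step: "\<And>z. z \<in> S_infty \<Longrightarrow>
      (\<And>i. 1 \<le> i \<Longrightarrow> z (i + 1) < z i \<Longrightarrow> P (z \<circ> transpose i (i + 1))) \<Longrightarrow> P z"
  shows "P z"
  using assms(1)
proof (induction "card (inversions z)" arbitrary: z rule: less_induct)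
  case less
  then show ?case using step card_inversions_descent by simp
qed

text \<open>Newman's lemma for the rewriting steps $z \to z s_i$ at descents: locally, two steps are
  joined by the commutation or the braid relation.\<close>

inductive descent_rel :: "(nat \<Rightarrow> 'a \<Rightarrow> 'a) \<Rightarrow> 'a \<Rightarrow> (nat \<Rightarrow> nat) \<Rightarrow> 'a \<Rightarrow> bool"
  for F b where
  id: "descent_rel F b id b"
| step: "1 \<le> i \<Longrightarrow> z (i + 1) < z i \<Longrightarrow> descent_rel F b (z \<circ> transpose i (i + 1)) x \<Longrightarrow>
    descent_rel F b z (F i x)"

lemma transpose_commute:
  assumes "i + 2 \<le> (j::nat)"
  shows "transpose i (i + 1) \<circ> transpose j (j + 1) = transpose j (j + 1) \<circ> transpose i (i + 1)"
  using assms by (auto simp: transpose_def fun_eq_iff)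

lemma transpose_braid:
  "transpose i (i + 1) \<circ> (transpose (i + 1) (i + 2) \<circ> transpose i (i + 1)) =
   transpose (i + 1) (i + 2) \<circ> (transpose i (i + 1) \<circ> transpose (i + 1) (i + (2::nat)))"
  by (auto simp: transpose_def fun_eq_iff)

lemma descent_rel_id_iff: "descent_rel F b id x \<longleftrightarrow> x = b"
proof
  assume "descent_rel F b id x"
  then show "x = b" by cases auto
qed (simp add: descent_rel.id)

lemma descent_rel_exists: "z \<in> S_infty \<Longrightarrow> \<exists>x. descent_rel F b z x"
proof (induction rule: S_infty_descent_induct)
  case (descent z)
  then show ?case by (metis descent_rel.intros S_infty_no_descent_imp_id)
qed

text \<open>By induction each permutation one step below \<open>z\<close> has a single value V. Two
  descents of \<open>z\<close> lead to a common permutation further down, and any value chosen there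
  forces the two results to agree.\<close>

lemma descent_rel_ex1:
  fixes F :: "nat \<Rightarrow> 'a \<Rightarrow> 'a"
  assumes comm: "\<And>i j x. 1 \<le> i \<Longrightarrow> i + 2 \<le> j \<Longrightarrow> F i (F j x) = F j (F i x)"
    and braid: "\<And>i x. 1 \<le> i \<Longrightarrow> F i (F (i + 1) (F i x)) = F (i + 1) (F i (F (i + 1) x))"
    and "z \<in> S_infty"
  shows "\<exists>!x. descent_rel F b z x"
  using assms(3)
proof (induction rule: S_infty_descent_induct)
  case (descent z)
  note z = descent.hyps
  define V where "V z = (THE x. descent_rel F b z x)" for z
  have uniq: "x = V y" if "\<exists>!x. descent_rel F b y x" "descent_rel F b y x" for x y
    unfolding V_def using that by (metis the_equality)
  have V: "descent_rel F b (z \<circ> transpose i (i + 1)) (V (z \<circ> transpose i (i + 1)))"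
    if "1 \<le> i" "z (i + 1) < z i" for i
    unfolding V_def using descent.IH[OF that] by (rule theI')
  have join: "F i x = F j y"
    if ij: "i < j" "1 \<le> i" and d: "z (i + 1) < z i" "z (j + 1) < z j"
      and x: "descent_rel F b (z \<circ> transpose i (i + 1)) x"
      and y: "descent_rel F b (z \<circ> transpose j (j + 1)) y" for i j x y
  proof (cases "j = i + 1")
    case False
    with ij have ij2: "i + 2 \<le> j" by simp
    let ?v = "z \<circ> transpose i (i + 1) \<circ> transpose j (j + 1)"
    have v: "z \<circ> transpose j (j + 1) \<circ> transpose i (i + 1) = ?v"
      by (simp only: o_assoc[symmetric] transpose_commute[OF ij2])
    have di: "(z \<circ> transpose i (i + 1)) (j + 1) < (z \<circ> transpose i (i + 1)) j"
      and dj: "(z \<circ> transpose j (j + 1)) (i + 1) < (z \<circ> transpose j (j + 1)) i"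
      using d ij2 by (simp_all add: transpose_def)
    have "?v \<in> S_infty" using z ij by simp
    from descent_rel_exists[OF this, of F b] obtain w where w: "descent_rel F b ?v w" ..
    have j: "1 \<le> j" using ij by simp
    have "x = F j w"
      using uniq[OF descent.IH[OF ij(2) d(1)] x]
        uniq[OF descent.IH[OF ij(2) d(1)] descent_rel.step[OF j di w]] by simp
    moreover have "y = F i w"
      using uniq[OF descent.IH[OF j d(2)] y]
        uniq[OF descent.IH[OF j d(2)] descent_rel.step[OF ij(2) dj w[folded v]]] by simp
    ultimately show ?thesis using comm[OF ij(2) ij2] by simp
  next
    case True
    have j: "1 \<le> j" using ij by simp
    \<comment> \<open>Here z i > z (i + 1) > z (i + 2), so both paths reach \<open>?v\<close>, which
      is z times the longest element generated by s_i and s_{i+1}, through descents only.\<close>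
    let ?s = "transpose i (i + 1)" and ?t = "transpose (i + 1) (i + 2)"
    let ?v = "z \<circ> ?s \<circ> ?t \<circ> ?s"
    have v: "z \<circ> ?t \<circ> ?s \<circ> ?t = ?v"
      by (simp only: o_assoc[symmetric] transpose_braid)
    have d1: "(z \<circ> ?s) (i + 1 + 1) < (z \<circ> ?s) (i + 1)" "(z \<circ> ?s \<circ> ?t) (i + 1) < (z \<circ> ?s \<circ> ?t) i"
      and d2: "(z \<circ> ?t) (i + 1) < (z \<circ> ?t) i" "(z \<circ> ?t \<circ> ?s) (i + 1 + 1) < (z \<circ> ?t \<circ> ?s) (i + 1)"
      using d True by (simp_all add: transpose_def)
    have "?v \<in> S_infty"
      using z ij S_infty_comp_transpose(2)[of _ "Suc i"] by (simp add: numeral_2_eq_2)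
    from descent_rel_exists[OF this, of F b] obtain w where w: "descent_rel F b ?v w" ..
    have "descent_rel F b (z \<circ> ?s \<circ> ?t) (F i w)"
      by (rule descent_rel.step[OF ij(2) d1(2) w])
    then have x': "descent_rel F b (z \<circ> ?s) (F (i + 1) (F i w))"
      using descent_rel.step[where i = "i + 1" and z = "z \<circ> ?s" and F = F and b = b
          and x = "F i w", OF _ d1(1)] by simp
    have "x = F (i + 1) (F i w)"
      using uniq[OF descent.IH[OF ij(2) d(1)] x] uniq[OF descent.IH[OF ij(2) d(1)] x'] by simp
    moreover have "descent_rel F b (z \<circ> ?t \<circ> ?s) (F (i + 1) w)"
      using descent_rel.step[where i = "i + 1" and z = "z \<circ> ?t \<circ> ?s" and F = F and b = b
          and x = w, OF _ d2(2)] w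
      unfolding v[symmetric] by simp
    then have y': "descent_rel F b (z \<circ> ?t) (F i (F (i + 1) w))"
      by (rule descent_rel.step[OF ij(2) d2(1)])
    have "descent_rel F b (z \<circ> transpose j (j + 1)) (F i (F (i + 1) w))"
      using y' True by simp
    note y'' = uniq[OF descent.IH[OF j d(2)] this]
    have "y = F i (F (i + 1) w)"
      using uniq[OF descent.IH[OF j d(2)] y] y'' by simp
    ultimately show ?thesis using braid[OF ij(2)] True by simp
  qed
  show ?case
  proof (cases "z = id")
    case True
    show ?thesis unfolding True
      by (rule ex1I[of _ b]) (simp_all only: descent_rel_id_iff)
  next
    case False
    then obtain i where i: "1 \<le> i" "z (i + 1) < z i"
      using S_infty_no_descent_imp_id[OF z] by blast
    show ?thesis
    proof (rule ex1I)
      show "descent_rel F b z (F i (V (z \<circ> transpose i (i + 1))))"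
        by (rule descent_rel.step[OF i V[OF i]])
      fix x assume "descent_rel F b z x"
      then show "x = F i (V (z \<circ> transpose i (i + 1)))"
      proof cases
        case id
        then show ?thesis using False by simp
      next
        case (step j y)
        consider "i = j" | "i < j" | "j < i" by linarith
        then show ?thesis
        proof cases
          case 1
          then show ?thesis using uniq[OF descent.IH[OF step(2,3)] step(4)] step(1) by simp
        next
          case 2
          then show ?thesis using join[OF 2 i(1) i(2) step(3) V[OF i] step(4)] step by simp
        next
          case 3
          then show ?thesis using join[OF 3 step(2) step(3) i(2) step(4) V[OF i]] step by simp
        qed
      qed
    qed
  qed
qed

text \<open>It has two instances: precomposition with divided differences, starting from the
  constant term, and divided differences themselves, starting from a staircase monomial.\<close>

definition descent_rec :: "(nat \<Rightarrow> 'a \<Rightarrow> 'a) \<Rightarrow> 'a \<Rightarrow> (nat \<Rightarrow> nat) \<Rightarrow> 'a" where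
  "descent_rec F b z = (THE x. descent_rel F b z x)"

lemma descent_rec_id [simp]: "descent_rec F b id = b"
  by (simp only: descent_rec_def descent_rel_id_iff the_eq_trivial)

lemma descent_rec_step:
  fixes F :: "nat \<Rightarrow> 'a \<Rightarrow> 'a"
  assumes comm: "\<And>i j x. 1 \<le> i \<Longrightarrow> i + 2 \<le> j \<Longrightarrow> F i (F j x) = F j (F i x)"
    and braid: "\<And>i x. 1 \<le> i \<Longrightarrow> F i (F (i + 1) (F i x)) = F (i + 1) (F i (F (i + 1) x))"
    and z: "z \<in> S_infty" and i: "1 \<le> i" "z (i + 1) < z i"
  shows "descent_rec F b z = F i (descent_rec F b (z \<circ> transpose i (i + 1)))"
proof -
  have "descent_rel F b (z \<circ> transpose i (i + 1)) (descent_rec F b (z \<circ> transpose i (i + 1)))"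
    unfolding descent_rec_def
    by (rule theI', rule descent_rel_ex1) (use comm braid z i in auto)
  then have "descent_rel F b z (F i (descent_rec F b (z \<circ> transpose i (i + 1))))"
    by (rule descent_rel.step[OF i])
  moreover have "\<exists>!x. descent_rel F b z x"
    by (rule descent_rel_ex1) (use comm braid z in auto)
  ultimately show ?thesis
    unfolding descent_rec_def[of F b z] by (simp add: the1_equality)
qed

section \<open>Functionals dual to Schubert polynomials\<close>

text \<open>Polynomials in $x_1,\dots,x_k$ whose monomials have degrees between $e$ and $d$.\<close>

inductive bounded_poly :: "nat \<Rightarrow> nat \<Rightarrow> nat \<Rightarrow> zpoly \<Rightarrow> bool" for k where
  zero: "bounded_poly k e d 0"
| const: "bounded_poly k 0 d (of_int c)"
| add: "bounded_poly k e d f \<Longrightarrow> bounded_poly k e d g \<Longrightarrow> bounded_poly k e d (f + g)"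
| var_mult: "1 \<le> j \<Longrightarrow> j \<le> k \<Longrightarrow> e' \<le> Suc e \<Longrightarrow> bounded_poly k e d f \<Longrightarrow>
    bounded_poly k e' (Suc d) (var j * f)"

lemma bounded_poly_mono:
  "bounded_poly k e d f \<Longrightarrow> k \<le> k' \<Longrightarrow> e' \<le> e \<Longrightarrow> d \<le> d' \<Longrightarrow> bounded_poly k' e' d' f"
proof (induction arbitrary: e' d' rule: bounded_poly.induct)
  case (var_mult j e1 e d f)
  then obtain d1 where "d' = Suc d1" "d \<le> d1" by (cases d') auto
  then show ?case using var_mult bounded_poly.var_mult[of j k' e' e d1 f] by auto
qed (auto intro: bounded_poly.intros)

lemma bounded_poly_of_int_mult: "bounded_poly k e d f \<Longrightarrow> bounded_poly k e d (of_int c * f)"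
proof (induction rule: bounded_poly.induct)
  case (const d c')
  then show ?case using bounded_poly.const[of k d "c * c'"] by simp
next
  case (add e d f g)
  then show ?case by (simp add: distrib_left bounded_poly.add)
next
  case (var_mult j e' e d f)
  then show ?case using bounded_poly.var_mult[of j k e' e d "of_int c * f"] by (simp add: ac_simps)
qed (simp add: bounded_poly.zero)

lemma bounded_poly_uminus: "bounded_poly k e d f \<Longrightarrow> bounded_poly k e d (- f)"
  using bounded_poly_of_int_mult[of k e d f "-1"] by simp

lemma bounded_poly_diff:
  "bounded_poly k e d f \<Longrightarrow> bounded_poly k e d g \<Longrightarrow> bounded_poly k e d (f - g)"
  using bounded_poly.add[of k e d f "- g"] bounded_poly_uminus[of k e d g] by simp

lemma bounded_poly_mult:
  "bounded_poly k e d f \<Longrightarrow> bounded_poly k 0 d' g \<Longrightarrow> bounded_poly k e (d + d') (f * g)"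
proof (induction rule: bounded_poly.induct)
  case (const d c)
  then show ?case using bounded_poly_mono[OF bounded_poly_of_int_mult[of k 0 d' g c], of k 0 "d + d'"] by simp
next
  case (add e d f g)
  then show ?case by (simp add: distrib_right bounded_poly.add)
next
  case (var_mult j e' e d f)
  then show ?case using bounded_poly.var_mult[of j k e' e "d + d'" "f * g"] by (simp add: ac_simps)
qed (simp add: bounded_poly.zero)

lemma bounded_poly_degree_0: "bounded_poly k e d f \<Longrightarrow> d = 0 \<Longrightarrow> \<exists>c. f = of_int c"
proof (induction rule: bounded_poly.induct)
  case (zero e d)
  then show ?case by (intro exI[of _ 0]) simp
next
  case (add e d f g)
  then show ?case by (metis of_int_add)
qed auto

lemma bounded_poly_divided_difference:
  "bounded_poly k e d f \<Longrightarrow> 1 \<le> i \<Longrightarrow>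
    bounded_poly (max k (i + 1)) (e - 1) (d - 1) (divided_difference i f)"
proof (induction rule: bounded_poly.induct)
  case (var_mult j e' e d f)
  let ?k = "max k (i + 1)"
  have 1: "bounded_poly ?k (e' - 1) d (divided_difference i (var j) * f)"
  proof -
    have "bounded_poly ?k (e' - 1) d f"
      using var_mult.hyps by (intro bounded_poly_mono[OF var_mult.hyps(4)]) auto
    then show ?thesis
      by (auto simp: divided_difference_var bounded_poly_uminus bounded_poly.zero)
  qed
  have 2: "bounded_poly ?k (e' - 1) d (swap_vars i (var j) * divided_difference i f)"
  proof (cases d)
    \<comment> \<open>The truncated \<open>d - 1\<close> leaves no room for the extra variable here,
      but then \<open>f\<close> is constant and its divided difference vanishes.\<close>
    case 0
    then obtain c where "f = of_int c" using bounded_poly_degree_0[OF var_mult.hyps(4)] by auto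
    then show ?thesis by (simp add: bounded_poly.zero)
  next
    case (Suc d1)
    have "bounded_poly ?k (e' - 1) (Suc (d - 1)) (var (transpose i (i + 1) j) * divided_difference i f)"
      using var_mult by (intro bounded_poly.var_mult[of _ _ _ "e - 1"]) (auto simp: transpose_def)
    then show ?thesis using Suc by simp
  qed
  show ?case using bounded_poly.add[OF 1 2] by (simp add: divided_difference_mult)
qed (auto simp: divided_difference_add intro: bounded_poly.intros)

abbreviation const_term :: "zpoly \<Rightarrow> int" where
  "const_term f \<equiv> Poly_Mapping.lookup f 0"

lemma const_term_var_mult [simp]: "const_term (var j * f) = 0"
proof -
  have "0 \<notin> Poly_Mapping.keys (var j * f)"
  proof
    assume "0 \<in> Poly_Mapping.keys (var j * f)"
    then obtain m where "0 = Poly_Mapping.single j (1::nat) + m"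
      using keys_mult[of "var j" f] by (auto simp: var_def)
    then have "Poly_Mapping.lookup 0 j = Poly_Mapping.lookup (Poly_Mapping.single j (1::nat) + m) j"
      by simp
    then show False by (simp add: lookup_add)
  qed
  then show ?thesis by (simp add: in_keys_iff)
qed

lemma const_term_of_int [simp]: "const_term (of_int c) = c"
  by (simp add: lookup_of_int)

lemma const_term_bounded_poly: "bounded_poly k e d f \<Longrightarrow> 1 \<le> e \<Longrightarrow> const_term f = 0"
  by (induction rule: bounded_poly.induct) (auto simp: lookup_add)

lemma keys_bounded_poly:
  "bounded_poly k e d f \<Longrightarrow> m \<in> Poly_Mapping.keys f \<Longrightarrow> Poly_Mapping.lookup m j \<noteq> 0 \<Longrightarrow> 1 \<le> j \<and> j \<le> k"
proof (induction arbitrary: m rule: bounded_poly.induct)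
  case (const d c)
  then show ?case by (auto simp: in_keys_iff lookup_of_int when_def split: if_splits)
next
  case (add e d f g)
  then show ?case using Poly_Mapping.keys_add[of f g] by blast
next
  case (var_mult j' e' e d f)
  then obtain m' where "m = Poly_Mapping.single j' 1 + m'" "m' \<in> Poly_Mapping.keys f"
    using keys_mult[of "var j'" f] by (auto simp: var_def)
  then show ?case using var_mult by (auto simp: lookup_add lookup_single when_def split: if_splits)
qed auto

lemma keys_swap_vars:
  "m \<in> Poly_Mapping.keys (swap_vars i f) \<longleftrightarrow>
    Poly_Mapping.map_key (transpose i (i + 1)) m \<in> Poly_Mapping.keys f"
  unfolding swap_vars_def by (subst keys_map_key) (auto simp del: One_nat_def)

text \<open>The variable x_{k+1} does not occur, and invariance under exchanging x_j and x_{j+1}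
  carries absence from j + 1 down to j.\<close>

lemma symmetric_bounded_poly_const:
  assumes f: "bounded_poly k e d f" and sym: "\<And>i. 1 \<le> i \<Longrightarrow> divided_difference i f = 0"
  shows "f = of_int (const_term f)"
proof -
  have no: "\<forall>m\<in>Poly_Mapping.keys f. Poly_Mapping.lookup m j = 0" if "1 \<le> j" "j \<le> k + 1" for j
    using that(2,1)
  proof (induction rule: inc_induct)
    case base
    then show ?case using keys_bounded_poly[OF f, of _ "k + 1"] by auto
  next
    case (step j)
    show ?case
    proof
      fix m assume m: "m \<in> Poly_Mapping.keys f"
      let ?m = "Poly_Mapping.map_key (transpose j (j + 1)) m"
      have "swap_vars j f = f" using sym step by (simp add: divided_difference_eq_0_iff)
      then have "?m \<in> Poly_Mapping.keys f"
        using m keys_swap_vars[of ?m j f] by simp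
      then have "Poly_Mapping.lookup ?m (Suc j) = 0" using step by auto
      then show "Poly_Mapping.lookup m j = 0" by (simp add: map_key.rep_eq)
    qed
  qed
  have "m = 0" if m: "m \<in> Poly_Mapping.keys f" for m
  proof (rule poly_mapping_eqI)
    fix j
    show "Poly_Mapping.lookup m j = Poly_Mapping.lookup 0 j"
      using no m keys_bounded_poly[OF f m, of j] by (cases "1 \<le> j \<and> j \<le> k") auto
  qed
  then show ?thesis
    by (intro poly_mapping_eqI) (auto simp: lookup_of_int when_def in_keys_iff)
qed

text \<open>The constant term of the divided difference indexed by $z$. It is the functional dual to
  $\mathfrak S_z$.\<close>

definition schubert_functional :: "(nat \<Rightarrow> nat) \<Rightarrow> zpoly \<Rightarrow> int" where
  "schubert_functional = descent_rec (\<lambda>i \<psi>. \<psi> \<circ> divided_difference i) const_term"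

lemma schubert_functional_id [simp]: "schubert_functional id f = const_term f"
  by (simp only: schubert_functional_def descent_rec_id)

lemma schubert_functional_descent:
  assumes "z \<in> S_infty" "1 \<le> i" "z (i + 1) < z i"
  shows "schubert_functional z f = schubert_functional (z \<circ> transpose i (i + 1)) (divided_difference i f)"
proof -
  have "schubert_functional z = schubert_functional (z \<circ> transpose i (i + 1)) \<circ> divided_difference i"
    unfolding schubert_functional_def
  proof (rule descent_rec_step[OF _ _ assms])
    show "x \<circ> divided_difference j \<circ> divided_difference i = x \<circ> divided_difference i \<circ> divided_difference j"
      if "i + 2 \<le> j" for i j and x :: "zpoly \<Rightarrow> int"
      using divided_difference_commute[OF that] by (simp add: fun_eq_iff)
    show "x \<circ> divided_difference i \<circ> divided_difference (i + 1) \<circ> divided_difference i =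
      x \<circ> divided_difference (i + 1) \<circ> divided_difference i \<circ> divided_difference (i + 1)"
      for i and x :: "zpoly \<Rightarrow> int"
      using divided_difference_braid[of i] by (simp add: fun_eq_iff)
  qed
  then show ?thesis by simp
qed

lemma schubert_functional_0 [simp]: "z \<in> S_infty \<Longrightarrow> schubert_functional z 0 = 0"
proof (induction rule: S_infty_descent_induct)
  case (descent z)
  show ?case
  proof (cases "\<exists>i\<ge>1. z (i + 1) < z i")
    case True
    then show ?thesis using descent schubert_functional_descent[of z _ 0] by (auto simp: comp_def)
  next
    case False
    then have "z = id" using descent S_infty_no_descent_imp_id by blast
    then show ?thesis by (simp only: schubert_functional_id lookup_zero)
  qed
qed

lemma schubert_functional_add:
  "z \<in> S_infty \<Longrightarrow> schubert_functional z (f + g) = schubert_functional z f + schubert_functional z g"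
proof (induction arbitrary: f g rule: S_infty_descent_induct)
  case (descent z)
  show ?case
  proof (cases "\<exists>i\<ge>1. z (i + 1) < z i")
    case True
    then show ?thesis
      using descent schubert_functional_descent[of z _] by (auto simp: divided_difference_add comp_def)
  next
    case False
    then have "z = id" using descent S_infty_no_descent_imp_id by blast
    then show ?thesis by (simp only: schubert_functional_id lookup_add)
  qed
qed

lemma schubert_functional_of_nat_mult:
  "z \<in> S_infty \<Longrightarrow> schubert_functional z (of_nat n * f) = int n * schubert_functional z f"
  by (induction n) (simp_all add: schubert_functional_add algebra_simps)

lemma schubert_functional_uminus:
  "z \<in> S_infty \<Longrightarrow> schubert_functional z (- f) = - schubert_functional z f"
  using schubert_functional_add[of z f "- f"] by simp

lemma schubert_functional_diff:
  "z \<in> S_infty \<Longrightarrow> schubert_functional z (f - g) = schubert_functional z f - schubert_functional z g"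
  using schubert_functional_add[of z f "- g"] by (simp add: schubert_functional_uminus)

lemma schubert_functional_of_int_mult:
  "z \<in> S_infty \<Longrightarrow> schubert_functional z (of_int c * f) = c * schubert_functional z f"
  by (cases c rule: int_cases2) (simp_all add: schubert_functional_of_nat_mult schubert_functional_uminus)

lemma schubert_functional_sum:
  "z \<in> S_infty \<Longrightarrow> schubert_functional z (\<Sum>a\<in>A. f a) = (\<Sum>a\<in>A. schubert_functional z (f a))"
  by (induction A rule: infinite_finite_induct) (simp_all add: schubert_functional_add)

text \<open>At an ascent this is \<open>schubert_functional_descent\<close> for z s_i read
  backwards; at a descent two copies of \<partial>_i meet and give 0.\<close>

lemma schubert_functional_divided_difference:
  assumes z: "z \<in> S_infty" and i: "1 \<le> i"
  shows "schubert_functional z (divided_difference i f) =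
    (if z i < z (i + 1) then schubert_functional (z \<circ> transpose i (i + 1)) f else 0)"
proof (cases "z i < z (i + 1)")
  case True
  have "schubert_functional (z \<circ> transpose i (i + 1)) f =
      schubert_functional (z \<circ> transpose i (i + 1) \<circ> transpose i (i + 1)) (divided_difference i f)"
    by (rule schubert_functional_descent) (use z i True in auto)
  then show ?thesis using True by (simp add: comp_assoc)
next
  case False
  then have "z (i + 1) < z i" using S_infty_not_descent_iff[OF z] by blast
  from schubert_functional_descent[OF z i this] False z i show ?thesis by simp
qed

text \<open>The functionals separate polynomials. Every \<partial>_i g is again killed by all of
  them and has smaller degree, so it is 0; thus g is constant, and the functional at
  \<open>id\<close> reads off the constant.\<close>

lemma schubert_functional_eq_0_imp:
  "bounded_poly k 0 d g \<Longrightarrow> (\<And>z. z \<in> S_infty \<Longrightarrow> schubert_functional z g = 0) \<Longrightarrow> g = 0"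
proof (induction d arbitrary: k g)
  case 0
  then obtain c where "g = of_int c" using bounded_poly_degree_0 by blast
  then show ?case using 0(2)[of id] by (simp del: id_apply)
next
  case (Suc d)
  have "divided_difference i g = 0" if i: "1 \<le> i" for i
  proof (rule Suc.IH)
    show "bounded_poly (max k (i + 1)) 0 d (divided_difference i g)"
      using bounded_poly_divided_difference[OF Suc.prems(1) i] by simp
    show "schubert_functional z (divided_difference i g) = 0" if "z \<in> S_infty" for z
      using Suc.prems(2)[OF S_infty_comp_transpose(1)[OF that i]]
      by (simp add: schubert_functional_divided_difference[OF that i] comp_def)
  qed
  from symmetric_bounded_poly_const[OF Suc.prems(1) this] have "g = of_int (const_term g)" .
  moreover have "const_term g = 0" using Suc.prems(2)[OF id_in_S_infty] by (simp only: schubert_functional_id)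
  ultimately show ?case by simp
qed

text \<open>A nonzero value at z other than \<open>id\<close> is a nonzero value at z s_i on
  \<partial>_i f for a descent i. Here i is at most k, since otherwise f involves neither x_i nor
  x_{i+1}; so the support lies in a finite union.\<close>

lemma finite_schubert_functional_support:
  "bounded_poly k 0 d f \<Longrightarrow> finite {z \<in> S_infty. schubert_functional z f \<noteq> 0}"
proof (induction d arbitrary: k f)
  case 0
  then obtain c where c: "f = of_int c" using bounded_poly_degree_0 by blast
  have "{z \<in> S_infty. schubert_functional z f \<noteq> 0} \<subseteq> {id}"
  proof safe
    fix z assume z: "z \<in> S_infty" "schubert_functional z f \<noteq> 0"
    show "z = id"
    proof (rule S_infty_no_descent_imp_id[OF z(1)])
      fix i :: nat assume "1 \<le> i"
      then show "\<not> z (i + 1) < z i"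
        using z schubert_functional_descent[OF z(1), of i f] by (auto simp: c)
    qed
  qed
  then show ?case by (rule finite_subset) simp
next
  case (Suc d)
  let ?A = "\<lambda>f. {z \<in> S_infty. schubert_functional z f \<noteq> 0}"
  have "?A f \<subseteq> {id} \<union> (\<Union>i\<in>{1..k}. (\<lambda>z. z \<circ> transpose i (i + 1)) ` ?A (divided_difference i f))"
  proof
    fix z assume z: "z \<in> ?A f"
    show "z \<in> {id} \<union> (\<Union>i\<in>{1..k}. (\<lambda>z. z \<circ> transpose i (i + 1)) ` ?A (divided_difference i f))"
    proof (cases "z = id")
      case False
      then obtain i where i: "1 \<le> i" "z (i + 1) < z i"
        using S_infty_no_descent_imp_id z by blast
      have v: "z \<circ> transpose i (i + 1) \<in> ?A (divided_difference i f)"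
        using z i schubert_functional_descent[of z i f] by simp
      have "i \<le> k"
      proof (rule ccontr)
        assume "\<not> i \<le> k"
        have "swap_vars i f = f"
          using Suc.prems
        proof (induction rule: bounded_poly.induct)
          case (var_mult j e' e d f)
          then show ?case using \<open>\<not> i \<le> k\<close> by (simp add: swap_vars_mult transpose_def)
        qed (simp_all add: swap_vars_add)
        then have "divided_difference i f = 0" by (simp add: divided_difference_eq_0_iff)
        then show False using v schubert_functional_0 by auto
      qed
      moreover have "z = (z \<circ> transpose i (i + 1)) \<circ> transpose i (i + 1)"
        by (simp add: comp_assoc)
      ultimately show ?thesis using v i by (intro UnI2 UN_I[of i] image_eqI[of z]) simp_all
    qed simp
  qed
  moreover have "finite (?A (divided_difference i f))" if "1 \<le> i" for i
    using Suc.IH bounded_poly_divided_difference[OF Suc.prems that] by simp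
  ultimately show ?case by (elim finite_subset) auto
qed

section \<open>Schubert polynomials\<close>

definition longest_perm :: "nat \<Rightarrow> nat \<Rightarrow> nat" where
  "longest_perm n = one_line (rev [1..<n + 1])"

lemma longest_perm_apply: "longest_perm n i = (if 1 \<le> i \<and> i \<le> n then n + 1 - i else i)"
  by (auto simp: longest_perm_def one_line_def rev_nth simp del: upt_Suc)

lemma longest_perm_longest_perm [simp]: "longest_perm n (longest_perm n i) = i"
  by (auto simp: longest_perm_apply)

lemma longest_perm_comp_longest_perm [simp]: "longest_perm n \<circ> longest_perm n = id"
  by (simp only: fun_eq_iff comp_apply longest_perm_longest_perm id_apply) simp

lemma longest_perm_permutes: "longest_perm n permutes {1..n}"
  by (rule bij_imp_permutes, rule bij_betw_byWitness[where f' = "longest_perm n"])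
     (auto simp: longest_perm_apply)

lemma longest_perm_permutes_mono: "n \<le> M \<Longrightarrow> longest_perm n permutes {1..M}"
  by (rule permutes_atLeast1_mono[OF longest_perm_permutes])

lemma permutes_in_S_infty: "w permutes {1..n} \<Longrightarrow> w \<in> S_infty"
  by (auto simp: S_infty_def)

lemma longest_perm_less_iff:
  "a \<in> {1..M} \<Longrightarrow> b \<in> {1..M} \<Longrightarrow> longest_perm M a < longest_perm M b \<longleftrightarrow> b < a"
  by (auto simp: longest_perm_apply)

definition staircase :: "nat \<Rightarrow> zpoly" where
  "staircase n = (\<Prod>i = 1..n. var i ^ (n - i))"

text \<open>The Schubert polynomial as computed inside S_M. Multiplying by the longest element on
  the left turns ascents of w into descents, so the defining recursion becomes an instance of
  \<open>descent_rec\<close>.\<close>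

definition schubert_below :: "nat \<Rightarrow> (nat \<Rightarrow> nat) \<Rightarrow> zpoly" where
  "schubert_below M w = descent_rec divided_difference (staircase M) (longest_perm M \<circ> w)"

lemma schubert_below_ascent:
  assumes w: "w permutes {1..M}" and i: "1 \<le> i" "i < M" and a: "w i < w (i + 1)"
  shows "schubert_below M w = divided_difference i (schubert_below M (w \<circ> transpose i (i + 1)))"
proof -
  have "w i \<in> {1..M}" "w (i + 1) \<in> {1..M}" using permutes_in_image[OF w] i by auto
  then have d: "(longest_perm M \<circ> w) (i + 1) < (longest_perm M \<circ> w) i"
    using a longest_perm_less_iff by simp
  show ?thesis
    unfolding schubert_below_def o_assoc
    by (rule descent_rec_step[OF _ _ _ i(1) d])
       (use divided_difference_commute divided_difference_braid
          permutes_in_S_infty[OF permutes_compose[OF w longest_perm_permutes]] in blast)+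
qed

lemma schubert_below_longest_perm_self: "schubert_below M (longest_perm M) = staircase M"
  by (simp only: schubert_below_def longest_perm_comp_longest_perm descent_rec_id)

text \<open>In one-line notation $n, \dots, n-k+1, n+1, n-k, \dots, 1$: these interpolate between the longest
  elements of $S_{n+1}$ and $S_n$.\<close>

definition partial_cycle :: "nat \<Rightarrow> nat \<Rightarrow> nat \<Rightarrow> nat" where
  "partial_cycle n k i = (if 1 \<le> i \<and> i \<le> k then n + 1 - i else if i = k + 1 then n + 1
     else longest_perm (n + 1) i)"

lemma partial_cycle_Suc:
  assumes "k < n"
  shows "partial_cycle n (Suc k) = partial_cycle n k \<circ> transpose (k + 1) (k + 2)"
proof
  fix i
  consider "i = k + 1" | "i = k + 2" | "i \<noteq> k + 1" "i \<noteq> k + 2" by blast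
  then show "partial_cycle n (Suc k) i = (partial_cycle n k \<circ> transpose (k + 1) (k + 2)) i"
    using assms by cases (auto simp: partial_cycle_def longest_perm_apply)
qed

lemma partial_cycle_0: "partial_cycle n 0 = longest_perm (n + 1)"
  by (auto simp: partial_cycle_def longest_perm_apply fun_eq_iff)

lemma partial_cycle_self: "partial_cycle n n = longest_perm n"
  by (auto simp: partial_cycle_def longest_perm_apply fun_eq_iff)

lemma partial_cycle_permutes: "k \<le> n \<Longrightarrow> partial_cycle n k permutes {1..n + 1}"
proof (induction k)
  case 0
  then show ?case using longest_perm_permutes by (simp only: partial_cycle_0)
next
  case (Suc k)
  then have "partial_cycle n k \<circ> transpose (k + 1) (k + 1 + 1) permutes {1..n + 1}"
    by (intro permutes_comp_transpose) auto
  then show ?case using partial_cycle_Suc[of k n] Suc by (simp add: numeral_2_eq_2 comp_def)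
qed

text \<open>In each step the exponent of x_{k+1} exceeds that of x_{k+2} by one. Splitting off one
  factor x_{k+1} leaves a polynomial symmetric in these two variables, so \<partial>_{k+1} merely
  removes that factor.\<close>

lemma schubert_below_partial_cycle:
  assumes M: "n < M" and base: "schubert_below M (longest_perm (n + 1)) = staircase (n + 1)"
    and "k \<le> n"
  shows "schubert_below M (partial_cycle n k) =
    (\<Prod>i = 1..k. var i ^ (n - i)) * (\<Prod>i = k + 1..n + 1. var i ^ (n + 1 - i))"
  using assms(3)
proof (induction k)
  case 0
  then show ?case using base by (simp only: partial_cycle_0 staircase_def) simp
next
  case (Suc k)
  let ?A = "\<Prod>i = 1..k. var i ^ (n - i)" and ?B = "\<Prod>i = k + 3..n + 1. var i ^ (n + 1 - i)"
  let ?x = "var (k + 1)" and ?y = "var (k + 2)" and ?e = "n - Suc k"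
  have "partial_cycle n (Suc k) permutes {1..M}"
    by (rule permutes_atLeast1_mono[OF partial_cycle_permutes[OF Suc.prems]]) (use M in simp)
  moreover have "partial_cycle n (Suc k) (k + 1) < partial_cycle n (Suc k) (k + 1 + 1)"
    using Suc.prems by (simp add: partial_cycle_def)
  ultimately have "schubert_below M (partial_cycle n (Suc k)) = divided_difference (k + 1)
      (schubert_below M (partial_cycle n (Suc k) \<circ> transpose (k + 1) (k + 1 + 1)))"
    using M Suc.prems by (intro schubert_below_ascent) auto
  also have "partial_cycle n (Suc k) \<circ> transpose (k + 1) (k + 1 + 1) = partial_cycle n k"
    using Suc.prems by (simp add: partial_cycle_Suc comp_assoc)
  also have "schubert_below M (partial_cycle n k) = ?A * (\<Prod>i = k + 1..n + 1. var i ^ (n + 1 - i))"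
    using Suc by simp
  also have "(\<Prod>i = k + 1..n + 1. var i ^ (n + 1 - i)) = ?x ^ (n - k) * (?y ^ ?e * ?B)"
    using Suc.prems by (simp add: prod.atLeast_Suc_atMost numeral_3_eq_3)
  also have "?x ^ (n - k) = ?x * ?x ^ ?e"
    using Suc.prems by (metis Suc_diff_le diff_Suc_Suc power_Suc)
  also have "?A * (?x * ?x ^ ?e * (?y ^ ?e * ?B)) = ?x * (?A * (?x * ?y) ^ ?e * ?B)"
    by (simp only: power_mult_distrib ac_simps)
  also have "divided_difference (k + 1) \<dots> = divided_difference (k + 1) ?x * (?A * (?x * ?y) ^ ?e * ?B)"
  proof (rule divided_difference_mult_symmetric)
    have "swap_vars (k + 1) ?A = ?A"
      unfolding swap_vars_prod swap_vars_power swap_vars_var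
      by (rule prod.cong) (auto simp: transpose_def)
    moreover have "swap_vars (k + 1) ?B = ?B"
      unfolding swap_vars_prod swap_vars_power swap_vars_var
      by (rule prod.cong) (auto simp: transpose_def)
    moreover have "swap_vars (k + 1) (?x * ?y) = ?x * ?y"
      by (simp add: swap_vars_mult mult.commute)
    ultimately show "swap_vars (k + 1) (?A * (?x * ?y) ^ ?e * ?B) = ?A * (?x * ?y) ^ ?e * ?B"
      by (simp only: swap_vars_mult[of _ _ ?B] swap_vars_mult[of _ ?A] swap_vars_power)
  qed
  also have "\<dots> = (\<Prod>i = 1..Suc k. var i ^ (n - i)) * (\<Prod>i = Suc k + 1..n + 1. var i ^ (n + 1 - i))"
    using Suc.prems
    by (simp add: divided_difference_var power_mult_distrib prod.atLeast_Suc_atMost numeral_3_eq_3 ac_simps)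
  finally show ?case .
qed

text \<open>Stability: each step of the downward induction from M runs through the partial cycles.
  This is why recursions started at different longest elements agree.\<close>

lemma schubert_below_longest_perm:
  "n \<le> M \<Longrightarrow> schubert_below M (longest_perm n) = staircase n"
proof (induction n rule: inc_induct)
  case base
  then show ?case by (rule schubert_below_longest_perm_self)
next
  case (step n)
  then have "schubert_below M (partial_cycle n n) =
    (\<Prod>i = 1..n. var i ^ (n - i)) * (\<Prod>i = n + 1..n + 1. var i ^ (n + 1 - i))"
    by (intro schubert_below_partial_cycle) auto
  then show ?case by (simp only: partial_cycle_self) (simp add: staircase_def)
qed

text \<open>A derivation fixes no ambient group, so the comparison is made for all large M; two
  derivations then meet in a common S_M.\<close>

lemma schubert_rel_imp_schubert_below:
  "schubert_rel w f \<Longrightarrow> \<exists>M0. \<forall>M\<ge>M0. w permutes {1..M} \<and> f = schubert_below M w"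
proof (induction rule: schubert_rel.induct)
  case (longest n)
  show ?case
    unfolding longest_perm_def[symmetric] staircase_def[symmetric]
    by (rule exI[of _ n]) (use schubert_below_longest_perm longest_perm_permutes_mono in auto)
next
  case (ascent i w f)
  then obtain M0 where M0: "\<And>M. M \<ge> M0 \<Longrightarrow> w \<circ> transpose i (i + 1) permutes {1..M} \<and>
    f = schubert_below M (w \<circ> transpose i (i + 1))" by blast
  show ?case
  proof (intro exI allI impI)
    fix M assume M: "M \<ge> max M0 (i + 2)"
    then have f: "w \<circ> transpose i (i + 1) permutes {1..M}" "f = schubert_below M (w \<circ> transpose i (i + 1))"
      using M0 by auto
    have "w \<circ> transpose i (i + 1) \<circ> transpose i (i + 1) permutes {1..M}"
      by (rule permutes_comp_transpose[OF f(1) ascent.hyps(1)]) (use M in simp)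
    then have w: "w permutes {1..M}" by (simp add: comp_assoc)
    show "w permutes {1..M} \<and> divided_difference i f = schubert_below M w"
      using w f(2) schubert_below_ascent[OF w ascent.hyps(1) _ ascent.hyps(2)] M by simp
  qed
qed

lemma schubert_rel_unique:
  assumes "schubert_rel w f" "schubert_rel w g"
  shows "f = g"
proof -
  obtain M1 M2 where "\<And>M. M \<ge> M1 \<Longrightarrow> f = schubert_below M w" "\<And>M. M \<ge> M2 \<Longrightarrow> g = schubert_below M w"
    using assms[THEN schubert_rel_imp_schubert_below] by blast
  from this(1)[of "max M1 M2"] this(2)[of "max M1 M2"] show ?thesis by simp
qed

lemma schubert_rel_exists:
  assumes "w \<in> S_infty"
  shows "\<exists>f. schubert_rel w f"
proof -
  obtain n where w: "w permutes {1..n}" using assms by (auto simp: S_infty_def)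
  \<comment> \<open>With z = w_0 w, descents of z are the ascents of w that the relation asks for,
    and z = \<open>id\<close> is the base case w_0.\<close>
  have *: "z permutes {1..n} \<Longrightarrow> \<exists>f. schubert_rel (longest_perm n \<circ> z) f" if "z \<in> S_infty" for z
    using that
  proof (induction rule: S_infty_descent_induct)
    case (descent z)
    show ?case
    proof (cases "z = id")
      case True
      show ?thesis unfolding True comp_id unfolding longest_perm_def by (rule exI, rule schubert_rel.longest)
    next
      case False
      then obtain i where i: "1 \<le> i" "z (i + 1) < z i"
        using S_infty_no_descent_imp_id descent.hyps by blast
      have "i < n"
      proof (rule ccontr)
        assume "\<not> i < n"
        then have "z (i + 1) = i + 1" "z i \<le> i"
          using descent.prems permutes_in_image[OF descent.prems, of i] i
          by (auto simp: permutes_def)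
        then show False using i by simp
      qed
      then have z': "z \<circ> transpose i (i + 1) permutes {1..n}"
        by (rule permutes_comp_transpose[OF descent.prems i(1)])
      from descent.IH[OF i this] obtain f where f: "schubert_rel (longest_perm n \<circ> (z \<circ> transpose i (i + 1))) f" ..
      have "(longest_perm n \<circ> z) i < (longest_perm n \<circ> z) (i + 1)"
        using longest_perm_less_iff[of "z i" n "z (i + 1)"] permutes_in_image[OF descent.prems, of i]
          permutes_in_image[OF descent.prems, of "i + 1"] i \<open>i < n\<close> by simp
      from schubert_rel.ascent[OF i(1) this f[unfolded o_assoc]] show ?thesis by (rule exI)
    qed
  qed
  have "longest_perm n \<circ> w permutes {1..n}" by (rule permutes_compose[OF w longest_perm_permutes])
  from *[OF permutes_in_S_infty[OF this] this] show ?thesis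
    by (simp only: o_assoc longest_perm_comp_longest_perm id_comp)
qed

section \<open>Schubert polynomials as the basis dual to the functionals\<close>

lemma schubert_eqI: "schubert_rel w f \<Longrightarrow> schubert w = f"
  unfolding schubert_def using schubert_rel_unique by blast

lemma schubert_rel_schubert: "w \<in> S_infty \<Longrightarrow> schubert_rel w (schubert w)"
  using schubert_rel_exists schubert_eqI by blast

lemma schubert_id [simp]: "schubert id = 1"
proof -
  have "longest_perm 0 = id" by (auto simp: longest_perm_apply fun_eq_iff)
  then show ?thesis using schubert_eqI[OF schubert_rel.longest[of 0, folded longest_perm_def]] by (simp del: id_apply)
qed

text \<open>At a descent the recursion is applied to w s_i; at an ascent the Schubert polynomial
  itself lies in the image of \<partial>_i, which squares to zero.\<close>

lemma divided_difference_schubert: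
  assumes w: "w \<in> S_infty" and i: "1 \<le> i"
  shows "divided_difference i (schubert w) =
    (if w (i + 1) < w i then schubert (w \<circ> transpose i (i + 1)) else 0)"
proof -
  have *: "schubert v = divided_difference i (schubert (v \<circ> transpose i (i + 1)))"
    if "v \<in> S_infty" "v i < v (i + 1)" for v
    by (rule schubert_eqI[OF schubert_rel.ascent[OF i that(2) schubert_rel_schubert]])
       (rule S_infty_comp_transpose(1)[OF that(1) i])
  show ?thesis
  proof (cases "w (i + 1) < w i")
    case True
    then show ?thesis
      using *[OF S_infty_comp_transpose(1)[OF w i]] by (simp add: comp_assoc)
  next
    case False
    then show ?thesis using *[OF w] S_infty_not_descent_iff[OF w, of i] by simp
  qed
qed

lemma bounded_poly_var_power: "1 \<le> i \<Longrightarrow> i \<le> k \<Longrightarrow> bounded_poly k e d f \<Longrightarrow>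
    bounded_poly k (e + a) (d + a) (var i ^ a * f)"
  by (induction a) (auto simp: mult.assoc intro!: bounded_poly.intros bounded_poly.const[of k 0 1, simplified])

text \<open>Equal bounds express homogeneity. The degree stays anonymous; for constant terms it only
  matters whether it is 0.\<close>

lemma schubert_homogeneous: "schubert_rel w f \<Longrightarrow> \<exists>k d. bounded_poly k d d f"
proof (induction rule: schubert_rel.induct)
  case (longest n)
  have "\<exists>d. bounded_poly n d d (\<Prod>i = 1..m. var i ^ (n - i))" if "m \<le> n" for m
    using that
  proof (induction m)
    case 0
    then show ?case using bounded_poly.const[of n 0 1] by auto
  next
    case (Suc m)
    then obtain d where "bounded_poly n d d (\<Prod>i = 1..m. var i ^ (n - i))" by auto
    then have "bounded_poly n (d + (n - Suc m)) (d + (n - Suc m))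
        (var (Suc m) ^ (n - Suc m) * (\<Prod>i = 1..m. var i ^ (n - i)))"
      using Suc.prems by (intro bounded_poly_var_power) auto
    then show ?case by (intro exI[of _ "d + (n - Suc m)"]) (simp add: mult.commute)
  qed
  from this[of n] show ?case by auto
next
  case (ascent i w f)
  then show ?case using bounded_poly_divided_difference by blast
qed

lemma schubert_neq_0: "w \<in> S_infty \<Longrightarrow> schubert w \<noteq> 0"
proof (induction rule: S_infty_descent_induct)
  case (descent z)
  show ?case
  proof (cases "z = id")
    case False
    then obtain i where i: "1 \<le> i" "z (i + 1) < z i"
      using S_infty_no_descent_imp_id descent.hyps by blast
    show ?thesis using descent.IH[OF i] divided_difference_schubert[OF descent.hyps i(1)] i by (auto simp: comp_def)
  qed (simp del: id_apply)
qed

text \<open>In degree 0 the polynomial would be a constant, killed by \<partial>_i at a descent i of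
  w; but that divided difference is a Schubert polynomial, hence nonzero.\<close>

lemma const_term_schubert:
  assumes w: "w \<in> S_infty"
  shows "const_term (schubert w) = (if w = id then 1 else 0)"
proof (cases "w = id")
  case False
  then obtain i where i: "1 \<le> i" "w (i + 1) < w i"
    using S_infty_no_descent_imp_id w by blast
  obtain k d where kd: "bounded_poly k d d (schubert w)"
    using schubert_homogeneous[OF schubert_rel_schubert[OF w]] by blast
  have "d \<noteq> 0"
  proof
    assume "d = 0"
    then obtain c where "schubert w = of_int c" using bounded_poly_degree_0 kd by blast
    then have "schubert (w \<circ> transpose i (i + 1)) = 0"
      using divided_difference_schubert[OF w i(1)] i by simp
    then show False using schubert_neq_0[OF S_infty_comp_transpose(1)[OF w i(1)]] by contradiction
  qed
  then show ?thesis using const_term_bounded_poly[OF kd] False by simp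
qed (simp del: id_apply add: lookup_one)

text \<open>Follow a descent i of z. If w descends there too, both permutations lose s_i; if not,
  \<partial>_i kills the Schubert polynomial, and z differs from w.\<close>

lemma schubert_functional_schubert:
  "z \<in> S_infty \<Longrightarrow> w \<in> S_infty \<Longrightarrow> schubert_functional z (schubert w) = (if z = w then 1 else 0)"
proof (induction arbitrary: w rule: S_infty_descent_induct)
  case (descent z)
  show ?case
  proof (cases "z = id")
    case True
    then show ?thesis using const_term_schubert[OF descent.prems] by (auto simp del: id_apply)
  next
    case False
    then obtain i where i: "1 \<le> i" "z (i + 1) < z i"
      using S_infty_no_descent_imp_id descent.hyps by blast
    let ?t = "transpose i (i + 1)"
    have eq: "z \<circ> ?t = w \<circ> ?t \<longleftrightarrow> z = w"
      by (metis comp_assoc transpose_comp_involutory comp_id)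
    have "schubert_functional z (schubert w) = schubert_functional (z \<circ> ?t) (divided_difference i (schubert w))"
      by (rule schubert_functional_descent[OF descent.hyps i])
    also have "\<dots> = (if w (i + 1) < w i then schubert_functional (z \<circ> ?t) (schubert (w \<circ> ?t)) else 0)"
      using schubert_functional_0[OF S_infty_comp_transpose(1)[OF descent.hyps i(1)]]
      by (simp add: divided_difference_schubert[OF descent.prems i(1)])
    also have "\<dots> = (if z = w then 1 else 0)"
      using descent.IH[OF i S_infty_comp_transpose(1)[OF descent.prems i(1)]] i(2)
      unfolding eq by (auto simp: comp_def)
    finally show ?thesis .
  qed
qed

text \<open>The difference of the two sides is killed by every functional, by duality.\<close>

lemma schubert_expansion_exists:
  assumes "bounded_poly k 0 d f"
  shows "f = (\<Sum>w | w \<in> S_infty \<and> schubert_functional w f \<noteq> 0. of_int (schubert_functional w f) * schubert w)"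
proof -
  let ?A = "{w. w \<in> S_infty \<and> schubert_functional w f \<noteq> 0}"
  define g where "g = (\<Sum>w\<in>?A. of_int (schubert_functional w f) * schubert w)"
  have fin: "finite ?A" using finite_schubert_functional_support[OF assms] .
  have "\<exists>k d. bounded_poly k 0 d (\<Sum>w\<in>B. of_int (schubert_functional w f) * schubert w)"
    if "finite B" "B \<subseteq> S_infty" for B
    using that
  proof (induction B rule: finite_induct)
    case empty
    show ?case using bounded_poly.zero by auto
  next
    case (insert w B)
    then obtain k1 d1 where 1: "bounded_poly k1 0 d1 (\<Sum>w\<in>B. of_int (schubert_functional w f) * schubert w)"
      by auto
    obtain k2 d2 where "bounded_poly k2 d2 d2 (schubert w)"
      using insert.prems schubert_homogeneous[OF schubert_rel_schubert] by blast
    then have 2: "bounded_poly k2 d2 d2 (of_int (schubert_functional w f) * schubert w)"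
      by (rule bounded_poly_of_int_mult)
    have "bounded_poly (max k1 k2) 0 (max d1 d2) (of_int (schubert_functional w f) * schubert w +
        (\<Sum>w\<in>B. of_int (schubert_functional w f) * schubert w))"
      by (intro bounded_poly.add bounded_poly_mono[OF 1] bounded_poly_mono[OF 2]) auto
    then show ?case using insert.hyps by auto
  qed
  then obtain k2 d2 where g: "bounded_poly k2 0 d2 g" unfolding g_def using fin by blast
  have "f - g = 0"
  proof (rule schubert_functional_eq_0_imp)
    show "bounded_poly (max k k2) 0 (max d d2) (f - g)"
      by (intro bounded_poly_diff bounded_poly_mono[OF assms] bounded_poly_mono[OF g]) auto
    fix z assume z: "z \<in> S_infty"
    have "schubert_functional z g = (\<Sum>w\<in>?A. if z = w then schubert_functional w f else 0)"
      unfolding g_def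
      by (auto simp: schubert_functional_sum z schubert_functional_of_int_mult
            schubert_functional_schubert intro!: sum.cong)
    also have "\<dots> = schubert_functional z f" using fin z by auto
    finally show "schubert_functional z (f - g) = 0" by (simp add: schubert_functional_diff z)
  qed
  then show ?thesis by (simp add: g_def)
qed

text \<open>Existence of the expansion supplies a witness for the definite description; applying the
  functional at z to any competing expansion recovers its coefficient at z.\<close>

lemma schubert_coeff_eq_schubert_functional:
  assumes u: "u \<in> S_infty" and v: "v \<in> S_infty" and w: "w \<in> S_infty"
  shows "schubert_coeff u v w = schubert_functional w (schubert u * schubert v)"
proof -
  let ?f = "schubert u * schubert v" let ?A = "{w \<in> S_infty. schubert_functional w ?f \<noteq> 0}"
  obtain k d k' d' where "bounded_poly k d d (schubert u)" "bounded_poly k' d' d' (schubert v)"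
    using schubert_homogeneous[OF schubert_rel_schubert] u v by meson
  then have f: "bounded_poly (max k k') 0 (d + d') ?f"
    by (intro bounded_poly_mult) (auto elim!: bounded_poly_mono)
  have fin: "finite ?A" using finite_schubert_functional_support[OF f] .
  define c where "c = Abs_poly_mapping (\<lambda>w. if w \<in> ?A then schubert_functional w ?f else 0)"
  have lookup_c: "Poly_Mapping.lookup c w = (if w \<in> ?A then schubert_functional w ?f else 0)" for w
    unfolding c_def by (subst lookup_Abs_poly_mapping) (use fin in auto)
  then have keys_c: "Poly_Mapping.keys c = ?A" by (intro set_eqI) (simp add: in_keys_iff)
  have "schubert_expansion u v = c"
    unfolding schubert_expansion_def
  proof (rule the_equality)
    show "Poly_Mapping.keys c \<subseteq> S_infty \<and>
        ?f = (\<Sum>w\<in>Poly_Mapping.keys c. of_int (Poly_Mapping.lookup c w) * schubert w)"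
    proof
      have "(\<Sum>w\<in>?A. of_int (Poly_Mapping.lookup c w) * schubert w) =
          (\<Sum>w\<in>?A. of_int (schubert_functional w ?f) * schubert w)"
        by (rule sum.cong) (auto simp: lookup_c)
      then show "?f = (\<Sum>w\<in>Poly_Mapping.keys c. of_int (Poly_Mapping.lookup c w) * schubert w)"
        unfolding keys_c using schubert_expansion_exists[OF f] by simp
    qed (auto simp: keys_c)
  next
    fix b assume b: "Poly_Mapping.keys b \<subseteq> S_infty \<and>
        ?f = (\<Sum>w\<in>Poly_Mapping.keys b. of_int (Poly_Mapping.lookup b w) * schubert w)"
    show "b = c"
    proof (rule poly_mapping_eqI)
      fix z
      show "Poly_Mapping.lookup b z = Poly_Mapping.lookup c z"
      proof (cases "z \<in> S_infty")
        case True
        have "schubert_functional z ?f =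
            (\<Sum>w\<in>Poly_Mapping.keys b. Poly_Mapping.lookup b w * schubert_functional z (schubert w))"
          using b by (simp add: schubert_functional_sum[OF True] schubert_functional_of_int_mult[OF True])
        also have "\<dots> = (\<Sum>w\<in>Poly_Mapping.keys b. if z = w then Poly_Mapping.lookup b w else 0)"
          by (rule sum.cong) (use b True in \<open>auto simp: schubert_functional_schubert\<close>)
        also have "\<dots> = Poly_Mapping.lookup b z" by (simp add: in_keys_iff)
        finally show ?thesis using True by (simp add: lookup_c)
      next
        case False
        then show ?thesis using b by (auto simp: lookup_c in_keys_iff)
      qed
    qed
  qed
  then show ?thesis using w by (simp add: schubert_coeff_def lookup_c)
qed

section \<open>Inversion codes\<close>

text \<open>The Lehmer code without ambient n and as a function of the position, so that one code
  serves all S_n. On \<open>S_infty\<close> it vanishes at position 0.\<close>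

definition inversion_code :: "(nat \<Rightarrow> nat) \<Rightarrow> nat \<Rightarrow> nat" where
  "inversion_code z i = card {j. i < j \<and> z j < z i}"

lemma finite_inversion_code_set:
  assumes "z \<in> S_infty"
  shows "finite {j. i < j \<and> z j < c}"
proof -
  have "finite (z -` {..<c})"
    by (rule finite_vimageI[OF _ S_infty_inj[OF assms]]) simp
  then show ?thesis by (rule rev_finite_subset) auto
qed

lemma inversion_code_id: "inversion_code id = (\<lambda>i. 0)"
  by (auto simp: inversion_code_def fun_eq_iff)

lemma inversion_code_ascent:
  assumes z: "z \<in> S_infty" and a: "z i < z (i + 1)"
  shows "inversion_code (z \<circ> transpose i (i + 1)) =
    (inversion_code z)(i := Suc (inversion_code z (i + 1)), i + 1 := inversion_code z i)"
proof
  fix k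
  let ?t = "transpose i (i + 1)"
  consider "k = i" | "k = i + 1" | "k \<noteq> i" "k \<noteq> i + 1" by blast
  then show "inversion_code (z \<circ> ?t) k =
      ((inversion_code z)(i := Suc (inversion_code z (i + 1)), i + 1 := inversion_code z i)) k"
  proof cases
    case 1
    have "{j. i < j \<and> (z \<circ> ?t) j < (z \<circ> ?t) i} = insert (i + 1) {j. i + 1 < j \<and> z j < z (i + 1)}"
      using a by (auto simp: transpose_def split: if_splits)
    then show ?thesis
      using 1 finite_inversion_code_set[OF z, of "i + 1" "z (i + 1)"] by (simp add: inversion_code_def)
  next
    case 2
    have "{j. i + 1 < j \<and> (z \<circ> ?t) j < (z \<circ> ?t) (i + 1)} = {j. i < j \<and> z j < z i}"
      using a by (auto simp: transpose_def split: if_splits)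
    then show ?thesis
      using 2 by (simp add: inversion_code_def)
  next
    case 3
    have "k < ?t j \<longleftrightarrow> k < j" for j using 3 by (auto simp: transpose_def)
    then have "{j. k < j \<and> (z \<circ> ?t) j < (z \<circ> ?t) k} = ?t -` {j. k < j \<and> z j < z k}"
      using 3 by (auto simp: transpose_def)
    also have "card \<dots> = card {j. k < j \<and> z j < z k}"
      by (rule card_vimage_inj) (auto simp: surj_def intro: exI[of _ "?t _"])
    finally show ?thesis using 3 by (simp add: inversion_code_def)
  qed
qed

lemma inversion_code_le_iff:
  assumes z: "z \<in> S_infty"
  shows "inversion_code z i \<le> inversion_code z (i + 1) \<longleftrightarrow> z i < z (i + 1)"
proof (cases "z i < z (i + 1)")
  case True
  then have "{j. i < j \<and> z j < z i} \<subseteq> {j. i + 1 < j \<and> z j < z (i + 1)}"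
    by auto (metis Suc_lessI less_asym')
  then have "inversion_code z i \<le> inversion_code z (i + 1)"
    unfolding inversion_code_def by (rule card_mono[OF finite_inversion_code_set[OF z]])
  then show ?thesis using True by simp
next
  case False
  then have d: "z (i + 1) < z i" using S_infty_not_descent_iff[OF z] by blast
  then have "insert (i + 1) {j. i + 1 < j \<and> z j < z (i + 1)} \<subseteq> {j. i < j \<and> z j < z i}"
    by auto
  from card_mono[OF finite_inversion_code_set[OF z] this]
  have "Suc (inversion_code z (i + 1)) \<le> inversion_code z i"
    using finite_inversion_code_set[OF z, of "i + 1" "z (i + 1)"] by (simp add: inversion_code_def)
  then show ?thesis using False by simp
qed

text \<open>Together with \<open>inversion_code_descent\<close> this lets inductions over descents
  run on codes, without evaluating permutations.\<close>

lemma inversion_code_descent_iff: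
  "z \<in> S_infty \<Longrightarrow> z (i + 1) < z i \<longleftrightarrow> inversion_code z (i + 1) < inversion_code z i"
  using inversion_code_le_iff[of z i] S_infty_not_descent_iff[of z i] by linarith

lemma inversion_code_descent:
  assumes z: "z \<in> S_infty" and i: "1 \<le> i" and d: "z (i + 1) < z i"
  shows "inversion_code (z \<circ> transpose i (i + 1)) =
    (inversion_code z)(i := inversion_code z (i + 1), i + 1 := inversion_code z i - 1)"
proof -
  let ?y = "z \<circ> transpose i (i + 1)"
  have "?y i < ?y (i + 1)" using d by simp
  moreover have "?y \<circ> transpose i (i + 1) = z" by (simp add: comp_assoc)
  ultimately have c: "inversion_code z = (inversion_code ?y)(i := Suc (inversion_code ?y (i + 1)), i + 1 := inversion_code ?y i)"
    using inversion_code_ascent[OF S_infty_comp_transpose(1)[OF z i]] by metis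
  show ?thesis
  proof
    fix k
    show "inversion_code ?y k =
      ((inversion_code z)(i := inversion_code z (i + 1), i + 1 := inversion_code z i - 1)) k"
      by (subst (1 2 3) c) auto
  qed
qed

text \<open>Equal codes have the same descents and remain equal after a common descent is removed; a
  zero code has no descents.\<close>

lemma inversion_code_inj:
  assumes "z \<in> S_infty" "y \<in> S_infty" "inversion_code z = inversion_code y"
  shows "z = y"
  using assms
proof (induction arbitrary: y rule: S_infty_descent_induct)
  case (descent z)
  show ?case
  proof (cases "z = id")
    case True
    have "inversion_code y = (\<lambda>i. 0)" using descent.prems(2) unfolding True inversion_code_id ..
    then have "\<not> y (i + 1) < y i" for i
      using inversion_code_descent_iff[OF descent.prems(1), of i] by simp
    then have "y = id" using S_infty_no_descent_imp_id[OF descent.prems(1)] by blast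
    then show ?thesis using True by (simp del: id_apply)
  next
    case False
    then obtain i where i: "1 \<le> i" "z (i + 1) < z i"
      using S_infty_no_descent_imp_id descent.hyps by blast
    then have "y (i + 1) < y i" 
      using inversion_code_descent_iff[OF descent.hyps, of i]
        inversion_code_descent_iff[OF descent.prems(1), of i] descent.prems(2) by simp
    then have "inversion_code (z \<circ> transpose i (i + 1)) = inversion_code (y \<circ> transpose i (i + 1))"
      using inversion_code_descent[OF descent.hyps i] inversion_code_descent[OF descent.prems(1) i(1)]
        descent.prems(2) by simp
    from descent.IH[OF i S_infty_comp_transpose(1)[OF descent.prems(1) i(1)] this]
    have "z \<circ> transpose i (i + 1) \<circ> transpose i (i + 1) = y \<circ> transpose i (i + 1) \<circ> transpose i (i + 1)"
      by (rule arg_cong)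
    then show ?thesis by (simp add: comp_assoc)
  qed
qed

lemma inversion_code_outside:
  assumes z: "z permutes {1..M}" and i: "i \<notin> {1..M}"
  shows "inversion_code z i = 0"
proof -
  have "{j. i < j \<and> z j < z i} = {}" using z i by (auto simp: permutes_def)
  then show ?thesis unfolding inversion_code_def by (simp only: card.empty)
qed

lemma lehmer_code_eq_inversion_code:
  assumes z: "z permutes {1..M}"
  shows "lehmer_code M z = map (inversion_code z) [1..<M + 1]"
proof -
  have "card {j. i < j \<and> j \<le> M \<and> z j < z i} = inversion_code z i" if i: "i \<in> set [1..<M + 1]" for i
  proof -
    have "j \<le> M" if j: "i < j" "z j < z i" for j
    proof (rule ccontr)
      assume "\<not> j \<le> M"
      then have "z j = j" using z by (auto simp: permutes_def)
      moreover have "z i \<le> M" using permutes_in_image[OF z, of i] i by auto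
      ultimately show False using j \<open>\<not> j \<le> M\<close> by simp
    qed
    then have "{j. i < j \<and> j \<le> M \<and> z j < z i} = {j. i < j \<and> z j < z i}" by blast
    then show ?thesis by (simp add: inversion_code_def)
  qed
  then show ?thesis unfolding lehmer_code_def by (intro map_cong) auto
qed

text \<open>A permutation with the dilated code is enough, since codes determine
  permutations.\<close>

lemma code_dilation_eqI:
  assumes N: "1 \<le> N" and u: "u permutes {1..n}" and z: "z permutes {1..N * n}"
    and code: "inversion_code z = (\<lambda>i. N * inversion_code u i)"
  shows "code_dilation n N u = z"
proof -
  have n: "n \<le> N * n" using N by simp
  let ?c = "map (\<lambda>c. N * c) (lehmer_code n u) @ replicate (N * n - n) 0"
  \<comment> \<open>The zeros padded on the right are the values of the code of u beyond n.\<close>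
  have c: "?c = map (\<lambda>i. N * inversion_code u i) [1..<N * n + 1]"
  proof (rule nth_equalityI)
    show "length ?c = length (map (\<lambda>i. N * inversion_code u i) [1..<N * n + 1])"
      using n by (simp add: lehmer_code_def del: upt_Suc)
    fix i assume "i < length ?c"
    then have "i < N * n" using n by (simp add: lehmer_code_def del: upt_Suc)
    then show "?c ! i = map (\<lambda>i. N * inversion_code u i) [1..<N * n + 1] ! i"
      using inversion_code_outside[OF u, of "i + 1"]
      by (auto simp: lehmer_code_eq_inversion_code[OF u] nth_append simp del: upt_Suc)
  qed
  show ?thesis
    unfolding code_dilation_def c
  proof (rule the_equality)
    show "z permutes {1..N * n} \<and> lehmer_code (N * n) z = map (\<lambda>i. N * inversion_code u i) [1..<N * n + 1]"
      using z code by (simp add: lehmer_code_eq_inversion_code del: upt_Suc)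
  next
    fix y assume y: "y permutes {1..N * n} \<and> lehmer_code (N * n) y = map (\<lambda>i. N * inversion_code u i) [1..<N * n + 1]"
    then have "map (inversion_code y) [1..<N * n + 1] = map (inversion_code z) [1..<N * n + 1]"
      using lehmer_code_eq_inversion_code[of y "N * n"] by (simp only: code)
    then have "inversion_code y i = inversion_code z i" if "i \<in> {1..N * n}" for i
      using that unfolding map_eq_conv by (simp del: upt_Suc)
    then have "inversion_code y = inversion_code z"
      using inversion_code_outside[OF z] inversion_code_outside[of y "N * n"] y by (metis ext)
    then show "y = z" using inversion_code_inj y z permutes_in_S_infty by blast
  qed
qed

section \<open>Permutations with prescribed code\<close>

fun add_code :: "(nat \<Rightarrow> nat) \<Rightarrow> nat \<Rightarrow> nat \<Rightarrow> nat \<Rightarrow> nat" where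
  "add_code z k 0 = z"
| "add_code z k (Suc q) = add_code z (Suc k) q \<circ> transpose k (k + 1)"

lemma add_code_permutes:
  "z permutes {1..M} \<Longrightarrow> 1 \<le> k \<Longrightarrow> k + q \<le> M \<Longrightarrow> add_code z k q permutes {1..M}"
proof (induction q arbitrary: k)
  case (Suc q)
  then have "add_code z (Suc k) q permutes {1..M}" by simp
  from permutes_comp_transpose[OF this Suc.prems(2)] Suc.prems(3) show ?case
    by (simp only: add_code.simps)
qed simp

text \<open>\<open>add_code z k q\<close> is z s_{k+q-1} ... s_k. Each factor acts at an ascent,
  where it moves the new entry one place to the left and raises it by one.\<close>

lemma inversion_code_add_code:
  assumes "z \<in> S_infty" "1 \<le> k" "\<And>j. k \<le> j \<Longrightarrow> inversion_code z j = 0"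
  shows "add_code z k q \<in> S_infty \<and> inversion_code (add_code z k q) = (inversion_code z)(k := q)"
  using assms(2,3)
proof (induction q arbitrary: k)
  case 0
  then show ?case using assms(1) by auto
next
  case (Suc q)
  let ?y = "add_code z (Suc k) q"
  have y: "?y \<in> S_infty" and code: "inversion_code ?y = (inversion_code z)(Suc k := q)"
    using Suc by auto
  have "?y k < ?y (k + 1)"
    using inversion_code_le_iff[OF y, of k] Suc.prems by (simp add: code)
  from inversion_code_ascent[OF y this]
  have "inversion_code (?y \<circ> transpose k (k + 1)) = (inversion_code z)(k := Suc q)"
    using Suc.prems by (auto simp: code fun_eq_iff)
  then show ?case
    using S_infty_comp_transpose(1)[OF y Suc.prems(1)] by (simp only: add_code.simps simp_thms)
qed

text \<open>The family with code entries p at 1 and q at m, for m at least 2. It contains u, v and w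
  and is closed under dilation. The entry at m comes second because \<open>add_code\<close> needs
  zeros from its position on.\<close>

definition two_code_perm :: "nat \<Rightarrow> nat \<Rightarrow> nat \<Rightarrow> nat \<Rightarrow> nat" where
  "two_code_perm p m q = add_code (add_code id 1 p) m q"

lemma two_code_perm:
  assumes "2 \<le> m"
  shows "two_code_perm p m q \<in> S_infty"
    and "inversion_code (two_code_perm p m q) = (\<lambda>i. 0)(1 := p, m := q)"
proof -
  have 1: "add_code id 1 p \<in> S_infty \<and> inversion_code (add_code id 1 p) = (\<lambda>i. 0)(1 := p)"
    using inversion_code_add_code[OF id_in_S_infty, of 1] by (simp add: inversion_code_id del: id_apply)
  then have "add_code (add_code id 1 p) m q \<in> S_infty \<and>
      inversion_code (add_code (add_code id 1 p) m q) = (inversion_code (add_code id 1 p))(m := q)"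
    using assms by (intro inversion_code_add_code) auto
  with 1 show "two_code_perm p m q \<in> S_infty"
    "inversion_code (two_code_perm p m q) = (\<lambda>i. 0)(1 := p, m := q)"
    by (auto simp: two_code_perm_def)
qed

lemma two_code_perm_permutes:
  "2 \<le> m \<Longrightarrow> p + 1 \<le> M \<Longrightarrow> m + q \<le> M \<Longrightarrow> two_code_perm p m q permutes {1..M}"
  unfolding two_code_perm_def by (intro add_code_permutes permutes_id) auto

lemma code_dilation_two_code_perm:
  assumes "1 \<le> N" "2 \<le> m" "p + 1 \<le> n" "m + q \<le> n"
  shows "code_dilation n N (two_code_perm p m q) = two_code_perm (N * p) m (N * q)"
proof (rule code_dilation_eqI[OF assms(1)])
  show "two_code_perm p m q permutes {1..n}"
    using assms by (intro two_code_perm_permutes)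
  have "N * (p + 1) \<le> N * n" "N * (m + q) \<le> N * n"
    using assms by (intro mult_le_mono; simp)+
  \<comment> \<open>The slack m \<le> N m fits the undilated position m into the dilated bound N (m
    + q).\<close>
  moreover have "m \<le> N * m" using assms by simp
  ultimately have "N * p + 1 \<le> N * n" "m + N * q \<le> N * n"
    using assms(1) unfolding distrib_left by linarith+
  then show "two_code_perm (N * p) m (N * q) permutes {1..N * n}"
    by (intro two_code_perm_permutes assms(2))
qed (use assms in \<open>auto simp: two_code_perm fun_eq_iff\<close>)

lemma one_line_eq_two_code_perm_1:
  assumes "n \<ge> 7"
  shows "one_line ([2, 1] @ [3..<n - 1] @ [n, n - 1]) = two_code_perm 1 (n - 1) 1"
proof
  fix i
  have "two_code_perm 1 (n - 1) 1 i = (transpose 1 2 \<circ> transpose (n - 1) n) i"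
    using assms by (simp add: two_code_perm_def numeral_2_eq_2)
  moreover have "one_line ([2, 1] @ [3..<n - 1] @ [n, n - 1]) i = (transpose 1 2 \<circ> transpose (n - 1) n) i"
  proof -
    consider "i = 0" | "i = 1" | "i = 2" | "3 \<le> i" "i < n - 1" | "i = n - 1" | "i = n" | "n < i"
      using assms by linarith
    then show ?thesis
      using assms by cases (auto simp: one_line_def nth_append nth_Cons' transpose_def)
  qed
  ultimately show "one_line ([2, 1] @ [3..<n - 1] @ [n, n - 1]) i = two_code_perm 1 (n - 1) 1 i"
    by simp
qed

lemma one_line_eq_two_code_perm_3:
  assumes "n \<ge> 7"
  shows "one_line ([4, 1, 2, 3] @ [5..<n - 1] @ [n, n - 1]) = two_code_perm 3 (n - 1) 1"
proof
  fix i
  have "two_code_perm 3 (n - 1) 1 i = (transpose 3 4 \<circ> transpose 2 3 \<circ> transpose 1 2 \<circ> transpose (n - 1) n) i"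
    using assms by (simp add: two_code_perm_def numeral_2_eq_2 numeral_3_eq_3 eval_nat_numeral)
  moreover have "one_line ([4, 1, 2, 3] @ [5..<n - 1] @ [n, n - 1]) i =
     (transpose 3 4 \<circ> transpose 2 3 \<circ> transpose 1 2 \<circ> transpose (n - 1) n) i"
  proof -
    consider "i = 0" | "i = 1" | "i = 2" | "i = 3" | "i = 4" | "5 \<le> i" "i < n - 1" | "i = n - 1" | "i = n" | "n < i"
      using assms by linarith
    then show ?thesis
      using assms by cases (auto simp: one_line_def nth_append nth_Cons' transpose_def)
  qed
  ultimately show "one_line ([4, 1, 2, 3] @ [5..<n - 1] @ [n, n - 1]) i = two_code_perm 3 (n - 1) 1 i"
    by simp
qed

text \<open>Usually written 1 \<times> z. The fixed point 1 comes from
  \<open>z 0 = 0\<close>.\<close>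

definition shift_perm :: "(nat \<Rightarrow> nat) \<Rightarrow> nat \<Rightarrow> nat" where
  "shift_perm z i = (if i = 0 then 0 else Suc (z (i - 1)))"

lemma shift_perm_Suc [simp]: "shift_perm z (Suc i) = Suc (z i)"
  by (simp add: shift_perm_def)

lemma shift_perm_id: "shift_perm id = id"
  by (auto simp: shift_perm_def fun_eq_iff)

lemma shift_perm_S_infty:
  assumes "z \<in> S_infty"
  shows "shift_perm z \<in> S_infty"
proof -
  obtain n where n: "z permutes {1..n}" using assms by (auto simp: S_infty_def)
  have "shift_perm z permutes {1..Suc n}"
    unfolding permutes_def
  proof (intro conjI allI impI)
    fix x assume "x \<notin> {1..Suc n}"
    then show "shift_perm z x = x" using n by (cases x) (auto simp: permutes_def shift_perm_def)
  next
    fix y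
    show "\<exists>!x. shift_perm z x = y"
    proof (cases y)
      case 0
      then show ?thesis by (intro ex1I[of _ 0]) (auto simp: shift_perm_def split: if_splits)
    next
      case (Suc y')
      obtain x where x: "z x = y'" using permutes_surj[OF n] by (metis surjD)
      show ?thesis
      proof (rule ex1I[of _ "Suc x"])
        fix x' assume "shift_perm z x' = y"
        then show "x' = Suc x"
          using x Suc inj_eq[OF permutes_inj[OF n]] by (cases x') (auto simp: shift_perm_def)
      qed (use x Suc in simp)
    qed
  qed
  then show ?thesis by (rule permutes_in_S_infty)
qed

lemma inversion_code_shift_perm:
  "inversion_code (shift_perm z) (Suc i) = inversion_code z i"
  "inversion_code (shift_perm z) 0 = 0"
proof -
  have "{j. Suc i < j \<and> shift_perm z j < shift_perm z (Suc i)} = Suc ` {j. i < j \<and> z j < z i}"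
    by (auto simp: shift_perm_def image_iff gr0_conv_Suc split: if_splits)
  then show "inversion_code (shift_perm z) (Suc i) = inversion_code z i"
    by (simp add: inversion_code_def card_image)
qed (simp add: inversion_code_def shift_perm_def)

section \<open>Permutations whose code has two nonzero entries\<close>

text \<open>The complete homogeneous polynomial h_a(x_1, ..., x_k), split according to whether x_k
  occurs in a monomial.\<close>

fun hpoly :: "nat \<Rightarrow> nat \<Rightarrow> zpoly" where
  "hpoly k 0 = 1"
| "hpoly 0 (Suc a) = 0"
| "hpoly (Suc k) (Suc a) = hpoly k (Suc a) + var (Suc k) * hpoly (Suc k) a"

lemma hpoly_1: "hpoly (Suc 0) a = var 1 ^ a"
  by (induction a) simp_all

lemma swap_vars_hpoly_greater: "k < i \<Longrightarrow> swap_vars i (hpoly k a) = hpoly k a"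
  by (induction k a rule: hpoly.induct) (simp_all add: swap_vars_add swap_vars_mult transpose_def)

text \<open>Leibniz applied to the recursion for k + 1 variables: at i = k + 1 the terms reassemble
  into the recursion for k + 2 variables, at i = k they cancel.\<close>

lemma divided_difference_hpoly:
  "1 \<le> i \<Longrightarrow> divided_difference i (hpoly k a) = (if i = k \<and> 1 \<le> a then hpoly (Suc k) (a - 1) else 0)"
proof (induction k a rule: hpoly.induct)
  case (3 k a)
  consider "Suc k < i" | "i = Suc k" | "i = k" | "i < k" by linarith
  then show ?case
  proof cases
    case 1
    have "divided_difference i (hpoly (Suc k) (Suc a)) = 0"
      unfolding divided_difference_eq_0_iff by (rule swap_vars_hpoly_greater[OF 1])
    then show ?thesis using 1 by (simp del: hpoly.simps)
  next
    case 2
    then show ?thesis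
      using 3 by (cases a) (simp_all add: divided_difference_add divided_difference_mult divided_difference_var)
  qed (use 3 in \<open>simp_all add: divided_difference_add divided_difference_mult divided_difference_var\<close>)
qed simp_all

lemma swap_vars_hpoly: "1 \<le> i \<Longrightarrow> i \<noteq> k \<Longrightarrow> swap_vars i (hpoly k a) = hpoly k a"
  using divided_difference_hpoly[of i k a] by (simp add: divided_difference_eq_0_iff[symmetric])

lemma bounded_poly_hpoly: "bounded_poly k 0 a (hpoly k a)"
proof (induction k a rule: hpoly.induct)
  case (1 k)
  then show ?case using bounded_poly.const[of k 0 1] by simp
next
  case (2 a)
  then show ?case by (simp add: bounded_poly.zero)
next
  case (3 k a)
  then show ?case
    by (auto intro!: bounded_poly.add bounded_poly.var_mult elim: bounded_poly_mono)
qed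

lemma const_term_mult: "const_term (f * g) = const_term f * const_term g"
proof (induction f rule: zpoly_induct)
  case (const c)
  then show ?case
    using schubert_functional_of_int_mult[OF id_in_S_infty, of c g] by (simp only: schubert_functional_id const_term_of_int)
next
  case (add f g)
  then show ?case by (simp add: distrib_right lookup_add)
next
  case (var j f)
  then show ?case by (simp add: mult.assoc)
qed

lemma const_term_hpoly: "const_term (hpoly k a) = (if a = 0 then 1 else 0)"
  by (induction k a rule: hpoly.induct) (simp_all add: lookup_add)

text \<open>The Jacobi--Trudi determinant with entries $h_p$, $h_{q+j-i}$ in $x_1,\dots,x_i$ and
  $h_{p-j+i}$, $h_q$ in $x_1,\dots,x_j$. The case distinction stands for $h_a = 0$ at negative $a$,
  where truncated subtraction would give $h_0 = 1$.\<close>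

definition flagged_det :: "nat \<Rightarrow> nat \<Rightarrow> nat \<Rightarrow> nat \<Rightarrow> zpoly" where
  "flagged_det i j p q = hpoly i p * hpoly j q -
    (if j - i \<le> p then hpoly i (q + (j - i)) * hpoly j (p - (j - i)) else 0)"

lemma bounded_poly_flagged_det: "i < j \<Longrightarrow> bounded_poly j 0 (p + q) (flagged_det i j p q)"
proof -
  assume ij: "i < j"
  have *: "bounded_poly j 0 (a + b) (hpoly i a * hpoly j b)" for a b
    by (intro bounded_poly_mult bounded_poly_hpoly bounded_poly_mono[OF bounded_poly_hpoly]) (use ij in auto)
  show ?thesis
    using *[of p q] *[of "q + (j - i)" "p - (j - i)"]
    by (auto simp: flagged_det_def add.commute intro!: bounded_poly_diff bounded_poly.zero)
qed

lemma const_term_flagged_det: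
  "i < j \<Longrightarrow> const_term (flagged_det i j p q) = (if p = 0 \<and> q = 0 then 1 else 0)"
  by (auto simp: flagged_det_def lookup_minus const_term_mult const_term_hpoly)

lemma divided_difference_hpoly_mult:
  assumes "1 \<le> k" "i < j"
  shows "divided_difference k (hpoly i a * hpoly j b) =
    (if k = i \<and> 1 \<le> a then hpoly (Suc i) (a - 1) * hpoly j b
     else if k = j \<and> 1 \<le> b then hpoly i a * hpoly (Suc j) (b - 1) else 0)"
  using assms swap_vars_hpoly[of k i a]
  by (auto simp: divided_difference_mult divided_difference_hpoly)

text \<open>The determinant moves as the code with p at i and q at j does at a descent. If j = i +
  1, the two products become equal at k = i and cancel. For k = j and q = 0, the bound on p removes
  the second product, which would otherwise survive.\<close>

lemma divided_difference_flagged_det: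
  assumes "1 \<le> k" "i < j" "p < q + (j - i)"
  shows "divided_difference k (flagged_det i j p q) =
    (if k = i \<and> 1 \<le> p \<and> i + 1 < j then flagged_det (i + 1) j (p - 1) q
     else if k = j \<and> 1 \<le> q then flagged_det i (j + 1) p (q - 1) else 0)"
proof -
  have d: "divided_difference k (flagged_det i j p q) = divided_difference k (hpoly i p * hpoly j q) -
    (if j - i \<le> p then divided_difference k (hpoly i (q + (j - i)) * hpoly j (p - (j - i))) else 0)"
    by (simp add: flagged_det_def divided_difference_diff)
  consider "k \<noteq> i" "k \<noteq> j" | "k = i" "p = 0" | "k = i" "1 \<le> p" "j = i + 1" | "k = i" "1 \<le> p" "i + 1 < j"
    | "k = j" "q = 0" | "k = j" "1 \<le> q"
    using assms by linarith
  then show ?thesis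
  proof cases
    case 4
    moreover have "j - i \<le> p \<longleftrightarrow> j - (i + 1) \<le> p - 1" "q + (j - i) - 1 = q + (j - (i + 1))"
      "p - (j - i) = p - 1 - (j - (i + 1))"
      using 4 by auto
    ultimately show ?thesis
      unfolding d using assms
      by (simp only: divided_difference_hpoly_mult flagged_det_def) simp
  next
    case 6
    moreover have "q + (j - i) = q - 1 + (j + 1 - i)" "p - (j - i) - 1 = p - (j + 1 - i)"
      "1 \<le> p - (j - i) \<longleftrightarrow> j + 1 - i \<le> p" "j + 1 - i \<le> p \<Longrightarrow> j - i \<le> p"
      using 6 assms(2) by auto
    ultimately show ?thesis
      unfolding d unfolding divided_difference_hpoly_mult[OF assms(1,2)] flagged_det_def
      using assms(2) by auto
  qed (unfold d, use assms in \<open>auto simp: divided_difference_hpoly_mult divided_difference_hpoly mult.commute\<close>)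
qed

text \<open>By induction on the length p + q, both sides have the same divided differences, so they
  differ by a constant, and the constant terms agree. The bound on p excludes a descent at i when j
  = i + 1; both moves preserve it.\<close>

lemma schubert_eq_flagged_det:
  assumes "z \<in> S_infty" "1 \<le> i" "i < j" "p < q + (j - i)"
    and "inversion_code z = (\<lambda>k. 0)(i := p, j := q)"
  shows "schubert z = flagged_det i j p q"
  using assms
proof (induction "p + q" arbitrary: z i j p q rule: less_induct)
  case less
  note z = less.prems(1) and code = less.prems(5)
  have id: "z = id \<longleftrightarrow> p = 0 \<and> q = 0"
  proof
    assume "z = id"
    then have "(\<lambda>k. 0)(i := p, j := q) = (\<lambda>k. 0)" using code inversion_code_id by metis
    from fun_cong[OF this, of i] fun_cong[OF this, of j] show "p = 0 \<and> q = 0"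
      using less.prems(3) by simp
  next
    assume "p = 0 \<and> q = 0"
    then have "inversion_code z = inversion_code id" unfolding code inversion_code_id by auto
    then show "z = id" by (rule inversion_code_inj[OF z id_in_S_infty])
  qed
  have desc: "z (k + 1) < z k \<longleftrightarrow> (k = i \<and> 1 \<le> p \<and> i + 1 < j) \<or> (k = j \<and> 1 \<le> q)" for k
    unfolding inversion_code_descent_iff[OF z] code using less.prems(3,4) by auto
  have "divided_difference k (flagged_det i j p q - schubert z) = 0" if k: "1 \<le> k" for k
  proof -
    consider "k = i" "1 \<le> p" "i + 1 < j" | "k = j" "1 \<le> q"
      | "\<not> (k = i \<and> 1 \<le> p \<and> i + 1 < j)" "\<not> (k = j \<and> 1 \<le> q)" by blast
    then show ?thesis
    proof cases
      case 1
      then have d: "z (k + 1) < z k" using desc by blast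
      have "inversion_code (z \<circ> transpose k (k + 1)) = (\<lambda>k. 0)(i + 1 := p - 1, j := q)"
        unfolding inversion_code_descent[OF z k d] code using 1 by (auto simp: fun_eq_iff)
      with less.hyps[of "p - 1" q "z \<circ> transpose k (k + 1)" "i + 1" j] 1 k less.prems
      have "schubert (z \<circ> transpose k (k + 1)) = flagged_det (i + 1) j (p - 1) q" by simp
      then show ?thesis
        using 1 d divided_difference_schubert[OF z k] divided_difference_flagged_det[OF k less.prems(3,4)]
        by (simp add: divided_difference_diff)
    next
      case 2
      then have d: "z (k + 1) < z k" using desc by blast
      have "inversion_code (z \<circ> transpose k (k + 1)) = (\<lambda>k. 0)(i := p, j + 1 := q - 1)"
        unfolding inversion_code_descent[OF z k d] code using 2 less.prems(3) by (auto simp: fun_eq_iff)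
      with less.hyps[of p "q - 1" "z \<circ> transpose k (k + 1)" i "j + 1"] 2 k less.prems
      have "schubert (z \<circ> transpose k (k + 1)) = flagged_det i (j + 1) p (q - 1)" by simp
      then show ?thesis
        using 2 d less.prems(3) divided_difference_schubert[OF z k] divided_difference_flagged_det[OF k less.prems(3,4)]
        by (simp add: divided_difference_diff)
    next
      case 3
      then have "\<not> z (k + 1) < z k" using desc by blast
      then have "divided_difference k (schubert z) = 0"
        using divided_difference_schubert[OF z k] by simp
      moreover have "divided_difference k (flagged_det i j p q) = 0"
        unfolding divided_difference_flagged_det[OF k less.prems(3,4)] by (simp only: 3 if_False)
      ultimately show ?thesis by (simp add: divided_difference_diff)
    qed
  qed
  moreover have "\<exists>k d. bounded_poly k 0 d (flagged_det i j p q - schubert z)"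
  proof -
    obtain k d where kd: "bounded_poly k d d (schubert z)"
      using schubert_homogeneous[OF schubert_rel_schubert[OF z]] by blast
    have "bounded_poly (max j k) 0 (max (p + q) d) (flagged_det i j p q - schubert z)"
      by (intro bounded_poly_diff bounded_poly_mono[OF kd]
            bounded_poly_mono[OF bounded_poly_flagged_det[OF less.prems(3)]]) auto
    then show ?thesis by blast
  qed
  ultimately have "flagged_det i j p q - schubert z = of_int (const_term (flagged_det i j p q - schubert z))"
    using symmetric_bounded_poly_const by blast
  also have "const_term (flagged_det i j p q - schubert z) = 0"
    unfolding lookup_minus const_term_flagged_det[OF less.prems(3)] const_term_schubert[OF z] id by simp
  finally show ?case by simp
qed

text \<open>Each \<partial>_i passes the symmetric F, adds a variable to h and lowers its degree,
  while the code entry p moves right and drops by one. The bound q + (m - i) \<le> p keeps every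
  step a descent, also the last one, past q.\<close>

lemma schubert_functional_move_up:
  assumes "z \<in> S_infty" "z' \<in> S_infty" "1 \<le> i" "i < m" "q + (m - i) \<le> p" "m - i \<le> r"
    and "inversion_code z = (\<lambda>k. 0)(i := p, m := q)"
    and "inversion_code z' = (\<lambda>k. 0)(m - 1 := q, m := p - (m - i))"
    and sym: "\<And>k. 1 \<le> k \<Longrightarrow> k < m \<Longrightarrow> swap_vars k F = F"
  shows "schubert_functional z (hpoly i r * F) = schubert_functional z' (hpoly m (r - (m - i)) * F)"
  using assms(1-8)
proof (induction "m - i" arbitrary: z i p r rule: less_induct)
  case less
  note z = less.prems(1) and i = less.prems(3) and code = less.prems(7)
  let ?y = "z \<circ> transpose i (i + 1)"
  have d: "z (i + 1) < z i"
    unfolding inversion_code_descent_iff[OF z] code using less.prems by auto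
  have y: "?y \<in> S_infty" using S_infty_comp_transpose(1)[OF z i] .
  have r: "1 \<le> r" using less.prems(4,6) by simp
  have "schubert_functional z (hpoly i r * F) = schubert_functional ?y (divided_difference i (hpoly i r * F))"
    by (rule schubert_functional_descent[OF z i d])
  also have "divided_difference i (hpoly i r * F) = hpoly (i + 1) (r - 1) * F"
    using less.prems(4) r i sym[OF i]
    by (simp add: divided_difference_mult_symmetric divided_difference_hpoly)
  finally have 1: "schubert_functional z (hpoly i r * F) = schubert_functional ?y (hpoly (i + 1) (r - 1) * F)" .
  show ?case
  proof (cases "i + 1 = m")
    case True
    have "inversion_code ?y = inversion_code z'"
      unfolding inversion_code_descent[OF z i d] code less.prems(8) using True by (auto simp: fun_eq_iff)
    then have "?y = z'" by (rule inversion_code_inj[OF y less.prems(2)])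
    then show ?thesis using 1 True by (auto simp: comp_def)
  next
    case False
    have "inversion_code ?y = (\<lambda>k. 0)(i + 1 := p - 1, m := q)"
      unfolding inversion_code_descent[OF z i d] code using False less.prems(4) by (auto simp: fun_eq_iff)
    moreover have "p - 1 - (m - (i + 1)) = p - (m - i)" "r - 1 - (m - (i + 1)) = r - (m - i)"
      using False less.prems by auto
    ultimately show ?thesis
      using less.hyps[of "i + 1" ?y "p - 1" "r - 1"] y False less.prems 1 by simp
  qed
qed

section \<open>Reduction to two variables\<close>

text \<open>The graph of the substitution $x_1 \mapsto 0$, $x_{j+1} \mapsto x_j$ on polynomials that do
  not involve $x_0$.\<close>

inductive shift_rel :: "zpoly \<Rightarrow> zpoly \<Rightarrow> bool" where
  const: "shift_rel (of_int c) (of_int c)"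
| add: "shift_rel f g \<Longrightarrow> shift_rel f' g' \<Longrightarrow> shift_rel (f + f') (g + g')"
| var_1: "shift_rel (var 1 * f) 0"
| var_Suc: "1 \<le> j \<Longrightarrow> shift_rel f g \<Longrightarrow> shift_rel (var (Suc j) * f) (var j * g)"

lemma shift_rel_of_int_mult: "shift_rel f g \<Longrightarrow> shift_rel (of_int c * f) (of_int c * g)"
proof (induction rule: shift_rel.induct)
  case (const c')
  then show ?case using shift_rel.const[of "c * c'"] by simp
next
  case (add f g f' g')
  then show ?case by (simp add: distrib_left shift_rel.add)
next
  case (var_1 f)
  then show ?case using shift_rel.var_1[of "of_int c * f"] by (simp add: mult.left_commute)
next
  case (var_Suc j f g)
  then show ?case using shift_rel.var_Suc[of j "of_int c * f" "of_int c * g"] by (simp add: mult.left_commute)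
qed

lemma shift_rel_0: "shift_rel 0 0"
  using shift_rel.const[of 0] by simp

lemma shift_rel_mult: "shift_rel f g \<Longrightarrow> shift_rel f' g' \<Longrightarrow> shift_rel (f * f') (g * g')"
proof (induction rule: shift_rel.induct)
  case (var_1 f)
  then show ?case using shift_rel.var_1[of "f * f'"] by (simp add: mult.assoc)
qed (simp_all add: shift_rel_of_int_mult distrib_right shift_rel.add mult.assoc shift_rel.var_Suc)

lemma shift_rel_hpoly: "shift_rel (hpoly (Suc k) a) (hpoly k a)"
proof (induction k a rule: hpoly.induct)
  case (1 k)
  then show ?case using shift_rel.const[of 1] by simp
next
  case (2 a)
  then show ?case using shift_rel.var_1[of "hpoly (Suc 0) a"] by simp
next
  case (3 k a)
  then show ?case
    using shift_rel.add[OF 3(1) shift_rel.var_Suc[OF _ 3(2), of "Suc k"]] by (simp del: hpoly.simps add: hpoly.simps(3))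
qed

text \<open>For i \<ge> 1 the operator \<partial>_{i+1} does not touch x_1, so multiples of x_1 stay
  multiples of x_1.\<close>

lemma shift_rel_divided_difference:
  "shift_rel f g \<Longrightarrow> 1 \<le> i \<Longrightarrow> shift_rel (divided_difference (i + 1) f) (divided_difference i g)"
proof (induction rule: shift_rel.induct)
  case (var_1 f)
  then show ?case
    using shift_rel.var_1[of "divided_difference (i + 1) f"]
    by (simp add: divided_difference_mult divided_difference_var transpose_def)
next
  case (var_Suc j f g)
  have 1: "shift_rel (divided_difference (i + 1) (var (Suc j)) * f) (divided_difference i (var j) * g)"
    using shift_rel_of_int_mult[OF var_Suc.hyps(2), of 1] shift_rel_of_int_mult[OF var_Suc.hyps(2), of "-1"]
    by (auto simp: divided_difference_var shift_rel_0)
  have "transpose (i + 1) (i + 1 + 1) (Suc j) = Suc (transpose i (i + 1) j)" "1 \<le> transpose i (i + 1) j"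
    using var_Suc by (auto simp: transpose_def)
  then have 2: "shift_rel (swap_vars (i + 1) (var (Suc j)) * divided_difference (i + 1) f)
      (swap_vars i (var j) * divided_difference i g)"
    using shift_rel.var_Suc[of "transpose i (i + 1) j", OF _ var_Suc.IH[OF var_Suc.prems]]
    by (simp only: swap_vars_var)
  show ?case unfolding divided_difference_mult by (rule shift_rel.add[OF 1 2])
qed (simp_all add: divided_difference_add shift_rel_0 shift_rel.add)

lemma shift_rel_const_term: "shift_rel f g \<Longrightarrow> const_term f = const_term g"
  by (induction rule: shift_rel.induct) (simp_all add: lookup_add)

text \<open>The descents of 1 \<times> z are those of z moved up by one, so both recursions run in
  parallel down to constant terms, on which \<open>shift_rel\<close> agrees.\<close>

lemma schubert_functional_shift_perm:
  "z \<in> S_infty \<Longrightarrow> shift_rel f g \<Longrightarrow> schubert_functional (shift_perm z) f = schubert_functional z g"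
proof (induction arbitrary: f g rule: S_infty_descent_induct)
  case (descent z)
  show ?case
  proof (cases "z = id")
    case True
    show ?thesis unfolding True shift_perm_id schubert_functional_id
      by (rule shift_rel_const_term[OF descent.prems])
  next
    case False
    then obtain i where i: "1 \<le> i" "z (i + 1) < z i"
      using S_infty_no_descent_imp_id descent.hyps by blast
    have "shift_perm z (i + 1 + 1) < shift_perm z (i + 1)" using i by simp
    then have "schubert_functional (shift_perm z) f =
        schubert_functional (shift_perm z \<circ> transpose (i + 1) (i + 1 + 1)) (divided_difference (i + 1) f)"
      by (intro schubert_functional_descent shift_perm_S_infty descent.hyps) simp_all
    also have "shift_perm z \<circ> transpose (i + 1) (i + 1 + 1) = shift_perm (z \<circ> transpose i (i + 1))"
    proof
      fix k
      show "(shift_perm z \<circ> transpose (i + 1) (i + 1 + 1)) k = shift_perm (z \<circ> transpose i (i + 1)) k"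
        using i(1) by (cases k) (auto simp: shift_perm_def transpose_def)
    qed
    also have "schubert_functional \<dots> (divided_difference (i + 1) f) =
        schubert_functional (z \<circ> transpose i (i + 1)) (divided_difference i g)"
      by (rule descent.IH[OF i shift_rel_divided_difference[OF descent.prems i(1)]])
    also have "\<dots> = schubert_functional z g"
      by (rule schubert_functional_descent[OF descent.hyps i, symmetric])
    finally show ?thesis .
  qed
qed

lemma shift_perm_funpow_two_code_perm:
  "(shift_perm ^^ r) (two_code_perm a 2 b) \<in> S_infty \<and>
    inversion_code ((shift_perm ^^ r) (two_code_perm a 2 b)) = (\<lambda>k. 0)(r + 1 := a, r + 2 := b)"
proof (induction r)
  case 0
  then show ?case using two_code_perm[of 2 a b] by (simp add: numeral_2_eq_2 fun_eq_iff)
next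
  case (Suc r)
  let ?y = "two_code_perm a 2 b"
  have "inversion_code (shift_perm ((shift_perm ^^ r) ?y)) k =
      ((\<lambda>k. 0)(Suc r + 1 := a, Suc r + 2 := b)) k" for k
    using Suc by (cases k) (simp_all add: inversion_code_shift_perm)
  then show ?case using Suc shift_perm_S_infty by (simp add: fun_eq_iff)
qed

lemma schubert_functional_reduce_to_two_vars:
  "schubert_functional ((shift_perm ^^ r) (two_code_perm a 2 b))
      (hpoly (r + 2) A * hpoly (r + 2) B * hpoly (r + 2) C) =
    schubert_functional (two_code_perm a 2 b) (hpoly 2 A * hpoly 2 B * hpoly 2 C)"
proof (induction r)
  case 0
  then show ?case by (simp add: numeral_2_eq_2)
next
  case (Suc r)
  let ?z = "(shift_perm ^^ r) (two_code_perm a 2 b)"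
  have "schubert_functional (shift_perm ?z) (hpoly (Suc (r + 2)) A * hpoly (Suc (r + 2)) B * hpoly (Suc (r + 2)) C) =
      schubert_functional ?z (hpoly (r + 2) A * hpoly (r + 2) B * hpoly (r + 2) C)"
    by (rule schubert_functional_shift_perm)
       (use shift_perm_funpow_two_code_perm in \<open>auto intro!: shift_rel_mult shift_rel_hpoly simp del: hpoly.simps\<close>)
  then show ?case using Suc by simp
qed

section \<open>Complete homogeneous polynomials in two variables and their products\<close>

lemma hpoly_2_Suc: "hpoly 2 (Suc a) = var 1 ^ Suc a + var 2 * hpoly 2 a"
  using hpoly.simps(3)[of "Suc 0" a] by (simp only: hpoly_1 numeral_2_eq_2)

text \<open>A monomial of degree s + t + 1 has either x_1-exponent at least s + 1 or x_2-exponent at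
  least t + 1, never both.\<close>

lemma hpoly_2_add:
  "hpoly 2 (s + t + 1) = var 1 ^ (s + 1) * hpoly 2 t + var 2 ^ (t + 1) * hpoly 2 s"
proof (induction t)
  case (Suc t)
  have "hpoly 2 (s + Suc t + 1) = var 1 ^ Suc (s + t + 1) + var 2 * hpoly 2 (s + t + 1)"
    using hpoly_2_Suc[of "s + t + 1"] by simp
  also have "\<dots> = var 1 ^ (s + 1) * (var 1 ^ Suc t + var 2 * hpoly 2 t) + var 2 ^ (Suc t + 1) * hpoly 2 s"
    unfolding Suc by (simp add: algebra_simps power_add)
  finally show ?case by (simp only: hpoly_2_Suc)
qed (simp add: hpoly_2_Suc)

lemma hpoly_2_rec:
  "hpoly 2 (Suc (Suc a)) = (var 1 + var 2) * hpoly 2 (Suc a) - var 1 * var 2 * hpoly 2 a"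
  using hpoly_2_Suc[of "Suc a"] hpoly_2_Suc[of a] by (simp add: algebra_simps)

text \<open>As functions of b, both sides satisfy the three-term recurrence
  \<open>hpoly_2_rec\<close>; hence the two base cases.\<close>

lemma hpoly_2_mult_Suc:
  "hpoly 2 (Suc a) * hpoly 2 (Suc b) = hpoly 2 (Suc (Suc (a + b))) + var 1 * var 2 * (hpoly 2 a * hpoly 2 b)"
proof (induction b rule: induct_nat_012)
  case 0
  have "hpoly 2 (Suc 0) = var 1 + var 2" by (simp add: hpoly_2_Suc)
  then show ?case by (simp add: hpoly_2_rec algebra_simps)
next
  case 1
  have "hpoly 2 (Suc 0) = var 1 + var 2" by (simp add: hpoly_2_Suc)
  then show ?case by (simp add: hpoly_2_rec algebra_simps)
next
  case (ge2 b)
  let ?h = "hpoly 2" and ?x = "var 1 + var 2" and ?e = "var 1 * var 2"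
  have "?h (Suc a) * ?h (Suc (Suc (Suc b))) =
      ?x * (?h (Suc a) * ?h (Suc (Suc b))) - ?e * (?h (Suc a) * ?h (Suc b))"
    by (simp only: hpoly_2_rec[of "Suc b"]) (simp only: algebra_simps)
  also have "\<dots> = (?x * ?h (Suc (Suc (a + Suc b))) - ?e * ?h (Suc (Suc (a + b)))) +
      ?e * (?h a * (?x * ?h (Suc b) - ?e * ?h b))"
    unfolding ge2 by (simp only: algebra_simps)
  also have "\<dots> = ?h (Suc (Suc (a + Suc (Suc b)))) + ?e * (?h a * ?h (Suc (Suc b)))"
    by (simp only: hpoly_2_rec[of b] hpoly_2_rec[of "Suc (a + Suc b)"] hpoly_2_rec[of "Suc (Suc (a + b))"] add_Suc_right)
  finally show ?case .
qed

text \<open>The Clebsch-Gordan rule, or Pieri rule in two variables; \<open>hpoly_2_mult_Suc\<close>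
  peels off the summand k = 0.\<close>

lemma hpoly_2_mult:
  "hpoly 2 a * hpoly 2 b = (\<Sum>k\<le>min a b. (var 1 * var 2) ^ k * hpoly 2 (a + b - 2 * k))"
proof (induction a arbitrary: b)
  case (Suc a)
  show ?case
  proof (cases b)
    case (Suc b')
    let ?f = "\<lambda>k. (var 1 * var 2) ^ k * hpoly 2 (Suc a + b - 2 * k)"
    have "(\<Sum>k\<le>min (Suc a) b. ?f k) = ?f 0 + (\<Sum>k\<le>min a b'. ?f (Suc k))"
      by (simp only: Suc min_Suc_Suc sum.atMost_Suc_shift)
    also have "(\<Sum>k\<le>min a b'. ?f (Suc k)) =
        var 1 * var 2 * (\<Sum>k\<le>min a b'. (var 1 * var 2) ^ k * hpoly 2 (a + b' - 2 * k))"
      unfolding sum_distrib_left by (rule sum.cong[OF refl]) (simp add: Suc mult.assoc)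
    finally have "(\<Sum>k\<le>min (Suc a) b. ?f k) = hpoly 2 (Suc (Suc (a + b'))) +
        var 1 * var 2 * (\<Sum>k\<le>min a b'. (var 1 * var 2) ^ k * hpoly 2 (a + b' - 2 * k))"
      by (simp add: Suc)
    then show ?thesis using Suc.IH[of b'] hpoly_2_mult_Suc[of a b'] Suc by simp
  qed simp
qed simp

text \<open>These are the Schur polynomials of the two-row shapes (k + s, k), obtained from the
  determinant by cancelling with \<open>hpoly_2_add\<close>.\<close>

lemma two_var_schubert:
  "schubert (two_code_perm k 2 (k + s)) = (var 1 * var 2) ^ k * hpoly 2 s"
proof -
  have "schubert (two_code_perm k 2 (k + s)) = flagged_det 1 2 k (k + s)"
    by (rule schubert_eq_flagged_det) (use two_code_perm[of 2 k "k + s"] in auto)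
  also have "\<dots> = (var 1 * var 2) ^ k * hpoly 2 s"
  proof (cases k)
    case 0
    then show ?thesis by (simp add: flagged_det_def)
  next
    case (Suc t)
    have "flagged_det 1 2 k (k + s) = var 1 ^ k * (hpoly 2 (s + t + 1) - var 1 ^ (s + 1) * hpoly 2 t)"
      by (simp add: flagged_det_def Suc hpoly_1 algebra_simps power_add)
    also have "\<dots> = (var 1 * var 2) ^ k * hpoly 2 s"
      unfolding hpoly_2_add by (simp add: Suc power_mult_distrib algebra_simps)
    finally show ?thesis .
  qed
  finally show ?thesis .
qed

lemma two_code_perm_2_eq_iff: "two_code_perm a 2 b = two_code_perm c 2 d \<longleftrightarrow> a = c \<and> b = d"
proof
  assume "two_code_perm a 2 b = two_code_perm c 2 d"
  then have "(\<lambda>i. 0)(1 := a, 2 := b) = (\<lambda>i::nat. 0)(1 := c, 2 := d)"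
    using two_code_perm(2)[of 2 a b] two_code_perm(2)[of 2 c d] by simp
  from fun_cong[OF this, of 1] fun_cong[OF this, of 2] show "a = c \<and> b = d" by simp
qed simp

lemma schubert_functional_two_var:
  "schubert_functional (two_code_perm N 2 L) ((var 1 * var 2) ^ k * hpoly 2 s) =
    (if N = k \<and> L = k + s then 1 else 0)"
  unfolding two_var_schubert[symmetric]
  by (subst schubert_functional_schubert) (simp_all add: two_code_perm two_code_perm_2_eq_iff)

lemma schubert_functional_triple_product:
  assumes "A + B + C = N + L" "N \<le> L"
  shows "schubert_functional (two_code_perm N 2 L) (hpoly 2 A * hpoly 2 B * hpoly 2 C) =
    int (card {k. k \<le> A \<and> k \<le> B \<and> k \<le> N \<and> N + k \<le> A + B \<and> N \<le> C + k})"
proof -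
  let ?e = "var 1 * var 2" and ?\<phi> = "schubert_functional (two_code_perm N 2 L)"
  note y = two_code_perm(1)[of 2 N L, simplified]
  have "hpoly 2 A * hpoly 2 B * hpoly 2 C = (\<Sum>k\<le>min A B. ?e ^ k * (hpoly 2 (A + B - 2 * k) * hpoly 2 C))"
    by (simp add: hpoly_2_mult[of A B] sum_distrib_right mult.assoc)
  also have "\<dots> = (\<Sum>k\<le>min A B. \<Sum>j\<le>min (A + B - 2 * k) C.
      ?e ^ (k + j) * hpoly 2 (A + B - 2 * k + C - 2 * j))"
    unfolding hpoly_2_mult[of _ C] by (simp add: sum_distrib_left power_add mult.assoc)
  finally have "?\<phi> (hpoly 2 A * hpoly 2 B * hpoly 2 C) = (\<Sum>k\<le>min A B. \<Sum>j\<le>min (A + B - 2 * k) C.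
      if N = k + j \<and> L = k + j + (A + B - 2 * k + C - 2 * j) then 1 else 0)"
    by (simp only: schubert_functional_sum[OF y] schubert_functional_two_var)
  also have "\<dots> = (\<Sum>k\<le>min A B. if k \<le> N \<and> N + k \<le> A + B \<and> N \<le> C + k then 1 else 0)"
  proof (rule sum.cong[OF refl])
    fix k assume k: "k \<in> {..min A B}"
    \<comment> \<open>The two Clebsch-Gordan indices must add up to N, so j = N - k; the condition
      on L then follows from A + B + C = N + L.\<close>
    have "(\<Sum>j\<le>min (A + B - 2 * k) C. if N = k + j \<and> L = k + j + (A + B - 2 * k + C - 2 * j) then 1 else 0) =
      (\<Sum>j\<le>min (A + B - 2 * k) C. if j = N - k then (if k \<le> N then 1 else 0) else (0::int))"
      by (rule sum.cong[OF refl]) (use k assms in auto)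
    also have "\<dots> = (if N - k \<le> min (A + B - 2 * k) C then if k \<le> N then 1 else 0 else 0)"
      by (simp add: sum.delta)
    also have "\<dots> = (if k \<le> N \<and> N + k \<le> A + B \<and> N \<le> C + k then 1 else 0)"
      using k by auto
    finally show "(\<Sum>j\<le>min (A + B - 2 * k) C.
      if N = k + j \<and> L = k + j + (A + B - 2 * k + C - 2 * j) then 1 else 0) =
      (if k \<le> N \<and> N + k \<le> A + B \<and> N \<le> C + k then 1 else (0::int))" .
  qed
  also have "\<dots> = int (card {k. k \<le> A \<and> k \<le> B \<and> k \<le> N \<and> N + k \<le> A + B \<and> N \<le> C + k})"
  proof -
    have "{..min A B} \<inter> {k. k \<le> N \<and> N + k \<le> A + B \<and> N \<le> C + k} =
      {k. k \<le> A \<and> k \<le> B \<and> k \<le> N \<and> N + k \<le> A + B \<and> N \<le> C + k}" by auto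
    then show ?thesis by (simp add: sum.If_cases)
  qed
  finally show ?thesis .
qed

lemma schubert_coeff_two_code_perm:
  assumes m: "m = d + 1" and d: "1 \<le> d" "d \<le> N"
  shows "schubert_coeff (two_code_perm N m N) (two_code_perm N m N) (two_code_perm (3 * N) m N) =
    int (N + 1) - 2 * int (N - d + 1) + int (N + 1 - 2 * d)"
proof -
  have m2: "2 \<le> m" using m d by simp
  let ?u = "two_code_perm N m N" and ?w = "two_code_perm (3 * N) m N"
  let ?\<phi> = "schubert_functional ?w" and ?h = "hpoly m"
  \<comment> \<open>The Grassmannian permutation: its code is N at m - 1 and 3N - d at m, preceded
    by m - 2 zeros.\<close>
  let ?z = "(shift_perm ^^ (m - 2)) (two_code_perm N 2 (3 * N - d))"
  let ?C = "\<lambda>A B C. {k. k \<le> A \<and> k \<le> B \<and> k \<le> N \<and> N + k \<le> A + B \<and> N \<le> C + k}"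
  note u = two_code_perm[OF m2, of N N] and w = two_code_perm[OF m2, of "3 * N" N]
  have "schubert ?u = flagged_det 1 m N N"
    by (rule schubert_eq_flagged_det[OF u(1) _ _ _ u(2)]) (use m d in auto)
  then have S: "schubert ?u = hpoly 1 N * ?h N - hpoly 1 (N + d) * ?h (N - d)"
    using m d by (simp add: flagged_det_def)
  have "schubert ?u * schubert ?u = hpoly 1 (2 * N) * (?h N * ?h N) -
      of_int 2 * (hpoly 1 (2 * N + d) * (?h N * ?h (N - d))) +
      hpoly 1 (2 * N + 2 * d) * (?h (N - d) * ?h (N - d))"
  proof -
    have sq: "(x * p - y * q) * (x * p - y * q) = x * x * (p * p) - of_int 2 * (x * y * (p * q)) + y * y * (q * q)"
      for x y p q :: zpoly by (simp add: algebra_simps)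
    have h: "hpoly 1 (a + b) = hpoly 1 a * hpoly 1 b" for a b by (simp add: hpoly_1 power_add)
    have e: "2 * N = N + N" "N + N + d = N + (N + d)" "N + N + 2 * d = N + d + (N + d)" by simp_all
    show ?thesis unfolding S sq e h by (simp only: mult.assoc)
  qed
  then have "schubert_coeff ?u ?u ?w = ?\<phi> (hpoly 1 (2 * N) * (?h N * ?h N)) -
      2 * ?\<phi> (hpoly 1 (2 * N + d) * (?h N * ?h (N - d))) +
      ?\<phi> (hpoly 1 (2 * N + 2 * d) * (?h (N - d) * ?h (N - d)))"
    unfolding schubert_coeff_eq_schubert_functional[OF u(1) u(1) w(1)]
    by (simp only: schubert_functional_add[OF w(1)] schubert_functional_diff[OF w(1)]
        schubert_functional_of_int_mult[OF w(1)])
  \<comment> \<open>All three summands of the square have this shape; C is the degree left of r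
    after the d = m - 1 moves.\<close>
  moreover have *: "?\<phi> (hpoly 1 r * (?h A * ?h B)) = int (card (?C A B C))"
    if "A + B + C = 4 * N - d" and r: "r = C + d" for A B C r
  proof -
    have "?\<phi> (hpoly 1 r * (?h A * ?h B)) = schubert_functional ?z (?h (r - (m - 1)) * (?h A * ?h B))"
    proof (rule schubert_functional_move_up[OF w(1) _ _ _ _ _ w(2)])
      show "?z \<in> S_infty" "inversion_code ?z = (\<lambda>k. 0)(m - 1 := N, m := 3 * N - (m - 1))"
        using shift_perm_funpow_two_code_perm[of "m - 2" N "3 * N - d"] m d
        by (auto simp: numeral_2_eq_2)
      show "swap_vars k (?h A * ?h B) = ?h A * ?h B" if "1 \<le> k" "k < m" for k
        using that by (simp add: swap_vars_mult swap_vars_hpoly)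
    qed (use m d r in auto)
    also have "?h (r - (m - 1)) * (?h A * ?h B) = hpoly (m - 2 + 2) A * hpoly (m - 2 + 2) B * hpoly (m - 2 + 2) C"
      using m m2 r by (simp add: ac_simps)
    also have "schubert_functional ?z \<dots> =
        schubert_functional (two_code_perm N 2 (3 * N - d)) (hpoly 2 A * hpoly 2 B * hpoly 2 C)"
      by (rule schubert_functional_reduce_to_two_vars)
    also have "\<dots> = int (card (?C A B C))"
      by (rule schubert_functional_triple_product) (use that d in auto)
    finally show ?thesis .
  qed
  have "?\<phi> (hpoly 1 (2 * N) * (?h N * ?h N)) = int (card (?C N N (2 * N - d)))"
    by (rule *) (use d in auto)
  moreover have "?\<phi> (hpoly 1 (2 * N + d) * (?h N * ?h (N - d))) = int (card (?C N (N - d) (2 * N)))"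
    by (rule *) (use d in auto)
  moreover have "?\<phi> (hpoly 1 (2 * N + 2 * d) * (?h (N - d) * ?h (N - d))) =
      int (card (?C (N - d) (N - d) (2 * N + d)))"
    by (rule *) (use d in auto)
  \<comment> \<open>In the third set N + k \<le> 2 (N - d) means k + 2d \<le> N, so it is empty for
    N < 2d, in accordance with the truncated \<open>N + 1 - 2 * d\<close>.\<close>
  moreover have "?C N N (2 * N - d) = {..<N + 1}" "?C N (N - d) (2 * N) = {..<N - d + 1}"
    "?C (N - d) (N - d) (2 * N + d) = {..<N + 1 - 2 * d}"
    using d by auto
  ultimately show ?thesis by (simp only: card_lessThan)
qed

theorem theorem1p3:
  fixes n :: nat and u v w :: "nat \<Rightarrow> nat"
  assumes "n \<ge> 7"
    and "u = one_line ([2, 1] @ [3..<n - 1] @ [n, n - 1])"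
    and "v = one_line ([2, 1] @ [3..<n - 1] @ [n, n - 1])"
    and "w = one_line ([4, 1, 2, 3] @ [5..<n - 1] @ [n, n - 1])"
  shows "(\<forall>N. N = 2 * n - 6 \<longrightarrow>
           schubert_coeff (code_dilation n N u) (code_dilation n N v) (code_dilation n N w) = 1) \<and>
         (\<forall>N \<ge> 2 * n - 5.
           schubert_coeff (code_dilation n N u) (code_dilation n N v) (code_dilation n N w) = 0)"
proof -
  have uv: "u = two_code_perm 1 (n - 1) 1" "v = two_code_perm 1 (n - 1) 1"
    and w: "w = two_code_perm 3 (n - 1) 1"
    using assms one_line_eq_two_code_perm_1 one_line_eq_two_code_perm_3 by simp_all
  \<comment> \<open>Here d = n - 2, so 2d - 2 = 2n - 6; this lower bound on N also gives d \<le>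
    N.\<close>
  have "schubert_coeff (code_dilation n N u) (code_dilation n N v) (code_dilation n N w) =
      int (N + 1) - 2 * int (N - (n - 2) + 1) + int (N + 1 - 2 * (n - 2))" if "2 * n - 6 \<le> N" for N
  proof -
    have "code_dilation n N u = two_code_perm N (n - 1) N" "code_dilation n N v = two_code_perm N (n - 1) N"
      "code_dilation n N w = two_code_perm (3 * N) (n - 1) N"
      unfolding uv w using assms(1) that by (simp_all add: code_dilation_two_code_perm mult.commute)
    moreover have "schubert_coeff (two_code_perm N (n - 1) N) (two_code_perm N (n - 1) N)
        (two_code_perm (3 * N) (n - 1) N) =
      int (N + 1) - 2 * int (N - (n - 2) + 1) + int (N + 1 - 2 * (n - 2))"
      by (rule schubert_coeff_two_code_perm) (use assms(1) that in auto)
    ultimately show ?thesis by simp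
  qed
  \<comment> \<open>At N = 2n - 6 the last summand is truncated from -1 to 0, which leaves the value
    1; from 2n - 5 on nothing is truncated and the three terms cancel.\<close>
  then show ?thesis using assms(1) by (auto simp: of_nat_diff)
qed

end
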